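(* Let $(T(t))_{t\ge 0}$ be a bounded $C_0$-semigroup on a Hilbert space $X$, with generator $-A$. Assume that $\sigma(A)\cap i\mathbb{R}$ is empty, and that $$\|(is+A)^{-1}\|=O\left(\frac{|s|^{\alpha}}{\ell(|s|)}\right),\qquad |s|\to\infty,$$ where $\alpha>0$ and $\ell$ is decreasing and slowly varying. Then, for any $\varepsilon>0$, $$\|T(t)A^{-1}\|=O\left(\frac{(\log t)^{\varepsilon}}{(t\,k^{\#}(t))^{1/\alpha}}\right),\qquad t\to\infty,$$ where $k(t)=1/\ell(t^{1/\alpha})$ and $k^{\#}$ is the de Bruijn conjugate of $k$.
   Context: A strictly positive measurable function $\ell$ on $[a,\infty)$ (for some $a$) is slowly varying if $\lim_{s\to\infty}\ell(\lambda s)/\ell(s)=1$ for every $\lambda>0$. "Decreasing" means non-increasing. The de Bruijn conjugate of a slowly varying function $k$ is a slowly varying function $k^{\#}$ such that $k(s)\,k^{\#}(s\,k(s))\to 1$ and $k^{\#}(s)\,k(s\,k^{\#}(s))\to 1$ as $s\to\infty$; it exists and is unique up to asymptotic equivalence (ratio tending to $1$ at infinity). *)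

theory Defs
  imports "HOL-Analysis.Analysis" "HOL-Library.Landau_Symbols"
begin

text \<open>
  Complex Hilbert spaces. The real inner product and the norm of the underlying real space are
  tied to the complex inner product (linear in its first argument) by
  \<^term>\<open>inner x y = Re (cinner x y)\<close>. Hence positive definiteness of the complex inner product and
  the identity \<open>norm x = sqrt (Re (cinner x x))\<close> are inherited from \<^class>\<open>real_inner\<close>, and
  completeness from \<^class>\<open>banach\<close>.
\<close>

class complex_hilbert = real_inner + banach +
  fixes scaleC :: "complex \<Rightarrow> 'a \<Rightarrow> 'a" (infixr "*\<^sub>C" 75)
    and cinner :: "'a \<Rightarrow> 'a \<Rightarrow> complex"
  assumes scaleC_add_right: "a *\<^sub>C (x + y) = a *\<^sub>C x + a *\<^sub>C y"
    and scaleC_add_left: "(a + b) *\<^sub>C x = a *\<^sub>C x + b *\<^sub>C x"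
    and scaleC_scaleC: "a *\<^sub>C (b *\<^sub>C x) = (a * b) *\<^sub>C x"
    and scaleC_one: "1 *\<^sub>C x = x"
    and scaleR_scaleC: "scaleR r x = complex_of_real r *\<^sub>C x"
    and cinner_commute: "cinner x y = cnj (cinner y x)"
    and cinner_add_left: "cinner (x + y) z = cinner x z + cinner y z"
    and cinner_scaleC_left: "cinner (a *\<^sub>C x) y = a * cinner x y"
    and inner_eq_Re_cinner: "inner x y = Re (cinner x y)"

instantiation complex :: complex_hilbert
begin
definition scaleC_complex :: "complex \<Rightarrow> complex \<Rightarrow> complex" where
  "scaleC_complex a x = a * x"
definition cinner_complex :: "complex \<Rightarrow> complex \<Rightarrow> complex" where
  "cinner_complex x y = x * cnj y"
instance
  by standard
    (simp_all add: scaleC_complex_def cinner_complex_def algebra_simps scaleR_conv_of_real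
      inner_complex_def)
end

definition bounded_clinear :: "('a::complex_hilbert \<Rightarrow> 'a) \<Rightarrow> bool" where
  "bounded_clinear f \<longleftrightarrow> bounded_linear f \<and> (\<forall>c x. f (c *\<^sub>C x) = c *\<^sub>C f x)"


text \<open>Semigroups are functions on all of \<^typ>\<open>real\<close>, of which only the values at \<open>t \<ge> 0\<close> matter.\<close>

definition C0_semigroup :: "(real \<Rightarrow> 'a::complex_hilbert \<Rightarrow> 'a) \<Rightarrow> bool" where
  "C0_semigroup T \<longleftrightarrow>
     (\<forall>t\<ge>0. bounded_clinear (T t)) \<and>
     (\<forall>x. T 0 x = x) \<and>
     (\<forall>s\<ge>0. \<forall>t\<ge>0. \<forall>x. T (s + t) x = T s (T t x)) \<and>
     (\<forall>x. ((\<lambda>t. T t x) \<longlongrightarrow> x) (at_right 0))"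

definition bounded_semigroup :: "(real \<Rightarrow> 'a::complex_hilbert \<Rightarrow> 'a) \<Rightarrow> bool" where
  "bounded_semigroup T \<longleftrightarrow> (\<exists>M. \<forall>t\<ge>0. onorm (T t) \<le> M)"


text \<open>
  An unbounded operator is given by its domain \<open>D\<close> and a function \<open>G\<close> (or \<open>A\<close>) whose values outside
  \<open>D\<close> are irrelevant. Its inverse, when it maps \<open>D\<close> bijectively onto the space, is
  \<open>inv_into D G\<close>.
\<close>

definition is_generator ::
  "(real \<Rightarrow> 'a::complex_hilbert \<Rightarrow> 'a) \<Rightarrow> 'a set \<Rightarrow> ('a \<Rightarrow> 'a) \<Rightarrow> bool" where
  "is_generator T D G \<longleftrightarrow>
     D = {x. \<exists>y. ((\<lambda>h. (T h x - x) /\<^sub>R h) \<longlongrightarrow> y) (at_right 0)} \<and>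
     (\<forall>x\<in>D. ((\<lambda>h. (T h x - x) /\<^sub>R h) \<longlongrightarrow> G x) (at_right 0))"

definition resolvent_set :: "'a::complex_hilbert set \<Rightarrow> ('a \<Rightarrow> 'a) \<Rightarrow> complex set" where
  "resolvent_set D A =
     {z. bij_betw (\<lambda>x. z *\<^sub>C x - A x) D UNIV \<and>
         bounded_clinear (inv_into D (\<lambda>x. z *\<^sub>C x - A x))}"

definition op_spectrum :: "'a::complex_hilbert set \<Rightarrow> ('a \<Rightarrow> 'a) \<Rightarrow> complex set" where
  "op_spectrum D A = - resolvent_set D A"


definition slowly_varying_on :: "real \<Rightarrow> (real \<Rightarrow> real) \<Rightarrow> bool" where
  "slowly_varying_on a l \<longleftrightarrow>
     (\<forall>s\<ge>a. l s > 0) \<and>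
     l \<in> borel_measurable (lebesgue_on {a..}) \<and>
     (\<forall>c>0. ((\<lambda>s. l (c * s) / l s) \<longlongrightarrow> 1) at_top)"

text \<open>
  The de Bruijn conjugate of a slowly varying \<open>k\<close> is determined only up to asymptotic equivalence,
  so it is a relation between \<open>k\<close> and its conjugates \<open>kd\<close>.
\<close>

definition de_Bruijn_conjugate :: "(real \<Rightarrow> real) \<Rightarrow> (real \<Rightarrow> real) \<Rightarrow> bool" where
  "de_Bruijn_conjugate k kd \<longleftrightarrow>
     (\<exists>b. slowly_varying_on b kd) \<and>
     ((\<lambda>s. k s * kd (s * k s)) \<longlongrightarrow> 1) at_top \<and>
     ((\<lambda>s. kd s * k (s * kd s)) \<longlongrightarrow> 1) at_top"

end

theory Submission
  imports Defs "HOL-Probability.Probability"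
begin

text \<open>
  Write \<open>M s = s powr \<alpha> / l s\<close> for the assumed growth of the resolvent on the imaginary axis, and put
  \<open>R = (t * kd t) powr (1 / \<alpha>)\<close>. By the second relation defining the de Bruijn conjugate,
  \<open>M R\<close> is asymptotic to \<open>t\<close>, so that \<open>R\<close> is asymptotically the inverse of \<open>M\<close> at \<open>t\<close>. The
  estimate proved is \<open>O(1 / R)\<close>, which implies the claim because \<open>ln t \<ge> 1\<close> for \<open>t \<ge> exp 1\<close>.
  Its rate comes from smoothing orbits at the scale \<open>1 / R\<close>, and its sharpness from Plancherel's theorem,
  that is, from the Hilbert space structure; in this it follows Rozendaal, Seifert and Stahn.

  Fix \<open>t \<ge> 1\<close> and a vector \<open>x\<close>, let \<open>A u = x\<close>, put \<open>a = 1 / t\<close> and consider the damped orbit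
  \<open>h s = s ^ n * exp (- a * s) * T s u\<close> for \<open>s \<ge> 0\<close>, extended by zero. It is Lipschitz with a constant of order \<open>t ^ n\<close>, because applying
  the inverse of \<open>A\<close> makes orbits differentiable with bounded derivative. Averaging \<open>h\<close> against the
  Gaussian density with mean \<open>t\<close> and standard deviation \<open>1 / R\<close> therefore changes \<open>h t\<close>, which is
  \<open>t ^ n / e\<close> times the quantity to be estimated, only by \<open>O(t ^ n / R)\<close> (\<open>gaussian_average_le\<close>).

  The Gaussian average is expressed through the Laplace transform of \<open>h\<close>. Let \<open>L \<xi>\<close> be the inverse of
  \<open>a + \<i> * \<xi> + A\<close>. Then the average is a multiple of the integral over \<open>\<xi>\<close> of
  \<open>exp (- \<xi>\<^sup>2 / (2 * R\<^sup>2)) * exp (\<i> * \<xi> * t)\<close> times \<open>L \<xi>\<close> raised to the power \<open>n + 1\<close> and applied to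
  \<open>u\<close>. For large \<open>\<bar>\<xi>\<bar>\<close> the norm of \<open>L \<xi>\<close> is at most a constant times \<open>M \<bar>\<xi>\<bar>\<close>, and that of \<open>L \<xi>\<close> after the
  inverse of \<open>A\<close> gains a factor \<open>1 / (1 + \<bar>\<xi>\<bar>)\<close>. One factor \<open>L \<xi> x\<close> is kept and is square
  integrable in \<open>\<xi>\<close> with integral \<open>O(t)\<close>, by Plancherel (\<open>Plancherel_laplace\<close>); the outermost
  \<open>L \<xi>\<close> is undone by Plancherel in the other direction (\<open>norm_oscillatory_laplace_le\<close>) and contributes
  another square root of \<open>t\<close>. The remaining \<open>n - 1\<close> factors are bounded in norm by
  \<open>M \<bar>\<xi>\<bar> ^ (n - 1) / (1 + \<bar>\<xi>\<bar>)\<close>; weighted with the Gaussian this is at most a constant times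
  \<open>t ^ (n - 1) / R\<close> as soon as \<open>(n - 1) * \<alpha> \<ge> 1\<close> (\<open>regularly_varying_growth\<close>), since \<open>M R \<le> 2 * t\<close>.
  Altogether the average is \<open>O(t ^ n / R)\<close> as well (\<open>decay_from_resolvent_growth\<close>).

  At those \<open>t\<close> for which \<open>R\<close> is below a fixed threshold the claim is just the boundedness of the
  semigroup.
\<close>

section \<open>Complex Hilbert spaces\<close>

lemma scaleC_scaleR_left: "(r *\<^sub>R c) *\<^sub>C x = r *\<^sub>R (c *\<^sub>C (x::'a::complex_hilbert))"
  unfolding scaleR_conv_of_real scaleR_scaleC[of r "c *\<^sub>C x"] by (simp add: scaleC_scaleC)

lemma scaleC_scaleR_right: "c *\<^sub>C (r *\<^sub>R x) = r *\<^sub>R (c *\<^sub>C (x::'a::complex_hilbert))"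
  by (simp add: scaleR_scaleC scaleC_scaleC mult.commute)

lemma cinner_add_right: "cinner x (y + z) = cinner x y + cinner x (z::'a::complex_hilbert)"
  by (metis cinner_add_left cinner_commute complex_cnj_add)

lemma cinner_scaleC_right: "cinner x (c *\<^sub>C y) = cnj c * cinner x (y::'a::complex_hilbert)"
  by (metis cinner_scaleC_left cinner_commute complex_cnj_mult)

text \<open>
  The symmetry of the inner product makes \<open>cinner x x\<close> real.
\<close>

lemma cinner_self: "cinner x x = complex_of_real ((norm (x::'a::complex_hilbert))\<^sup>2)"
proof -
  have "Im (cinner x x) = 0" using cinner_commute[of x x] by (metis complex_cnj_cancel_iff Reals_cnj_iff complex_is_Real_iff)
  moreover have "Re (cinner x x) = (norm x)\<^sup>2" by (simp add: power2_norm_eq_inner inner_eq_Re_cinner)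
  ultimately show ?thesis by (simp add: complex_eq_iff)
qed

lemma norm_scaleC: "norm (c *\<^sub>C x) = cmod c * norm (x::'a::complex_hilbert)"
proof -
  have "cinner (c *\<^sub>C x) (c *\<^sub>C x) = (c * cnj c) * cinner x x"
    by (simp add: cinner_scaleC_left cinner_scaleC_right)
  then have "complex_of_real ((norm (c *\<^sub>C x))\<^sup>2) = complex_of_real ((cmod c * norm x)\<^sup>2)"
    by (simp add: cinner_self complex_norm_square[symmetric] power_mult_distrib)
  then have "(norm (c *\<^sub>C x))\<^sup>2 = (cmod c * norm x)\<^sup>2" using of_real_eq_iff by blast
  then show ?thesis by (simp add: power2_eq_iff_nonneg)
qed

text \<open>
  The complex Cauchy--Schwarz inequality follows from the real one: rotate \<open>x\<close> by a phase that makes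
  \<open>cinner x y\<close> real and nonnegative.
\<close>

lemma norm_cinner_le: "cmod (cinner x y) \<le> norm x * norm (y::'a::complex_hilbert)"
proof (cases "cinner x y = 0")
  case False
  define c where "c = cnj (sgn (cinner x y))"
  have c: "cmod c = 1" using False by (simp add: c_def norm_sgn)
  have "c * cinner x y = of_real (cmod (cinner x y))"
    using False by (simp add: c_def sgn_eq field_simps complex_norm_square[symmetric] power2_eq_square)
  then have "cmod (cinner x y) = Re (cinner (c *\<^sub>C x) y)" by (simp add: cinner_scaleC_left)
  also have "\<dots> = inner (c *\<^sub>C x) y" by (simp add: inner_eq_Re_cinner)
  also have "\<dots> \<le> norm (c *\<^sub>C x) * norm y" by (rule norm_cauchy_schwarz)
  finally show ?thesis by (simp add: norm_scaleC c)
qed simp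

lemma bounded_bilinear_scaleC: "bounded_bilinear (scaleC :: complex \<Rightarrow> 'a::complex_hilbert \<Rightarrow> 'a)"
  by (rule bounded_bilinear.intro)
    (auto simp: scaleC_add_left scaleC_add_right scaleC_scaleR_left scaleC_scaleR_right norm_scaleC intro!: exI[of _ 1])

lemma bounded_bilinear_cinner: "bounded_bilinear (cinner :: 'a::complex_hilbert \<Rightarrow> 'a \<Rightarrow> complex)"
proof (rule bounded_bilinear.intro)
  show "cinner (r *\<^sub>R a) b = r *\<^sub>R cinner a b" for r and a b :: 'a
    unfolding scaleR_conv_of_real scaleR_scaleC[of r a] by (simp add: cinner_scaleC_left)
  show "cinner a (r *\<^sub>R b) = r *\<^sub>R cinner a b" for r and a b :: 'a
    unfolding scaleR_conv_of_real scaleR_scaleC[of r b] by (simp add: cinner_scaleC_right)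
qed (auto simp: cinner_add_left cinner_add_right norm_cinner_le intro!: exI[of _ 1])

lemmas bounded_linear_cinner_left = bounded_bilinear.bounded_linear_left[OF bounded_bilinear_cinner]
lemmas cinner_simps = cinner_add_left cinner_add_right cinner_scaleC_left cinner_scaleC_right
  bounded_bilinear.diff_left[OF bounded_bilinear_cinner] bounded_bilinear.diff_right[OF bounded_bilinear_cinner]
  bounded_bilinear.minus_left[OF bounded_bilinear_cinner] bounded_bilinear.minus_right[OF bounded_bilinear_cinner]
  bounded_bilinear.zero_left[OF bounded_bilinear_cinner] bounded_bilinear.zero_right[OF bounded_bilinear_cinner]

lemma cinner_ext: "(\<And>y. cinner u y = cinner v y) \<Longrightarrow> u = (v::'a::complex_hilbert)"
proof -
  assume "\<And>y. cinner u y = cinner v y"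
  then have "cinner (u - v) (u - v) = 0" by (simp add: cinner_simps)
  then show ?thesis by (simp add: cinner_self)
qed

section \<open>Integrals tested against functionals\<close>

text \<open>
  Vector-valued integrals are Henstock--Kurzweil integrals, which make sense in an arbitrary Banach
  space, separable or not. All estimates and interchanges of integrals are made for scalar functions:
  this lemma passes to the Lebesgue integral after applying a continuous functional. The functional is
  arbitrary, so that a bounded operator may be moved under the integral sign as well.
\<close>

lemma weak_integral_dominated:
  fixes f :: "real \<Rightarrow> 'a::complex_hilbert" and F :: "'a \<Rightarrow> complex"
  assumes int: "\<And>a b. f integrable_on {a..b}"
    and bd: "\<And>x. norm (f x) \<le> g x" and g: "integrable lborel g"
    and F: "bounded_linear F" and meas: "(\<lambda>x. F (f x)) \<in> borel_measurable borel"
  shows "integrable lborel (\<lambda>x. F (f x))" "F (integral UNIV f) = (LBINT x. F (f x))"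
proof -
  obtain B where B: "\<And>x. norm (F x) \<le> norm x * B" using bounded_linear.bounded[OF F] by blast
  have "integrable lborel (\<lambda>x. g x * \<bar>B\<bar>)" using g by simp
  then show i: "integrable lborel (\<lambda>x. F (f x))"
  proof (rule Bochner_Integration.integrable_bound)
    show "AE x in lborel. norm (F (f x)) \<le> norm (g x * \<bar>B\<bar>)"
    proof (rule AE_I2)
      fix x
      have "norm (F (f x)) \<le> norm (f x) * B" by (rule B)
      also have "\<dots> \<le> norm (f x) * \<bar>B\<bar>" by (intro mult_left_mono) auto
      also have "\<dots> \<le> g x * \<bar>B\<bar>" using bd[of x] by (intro mult_right_mono) auto
      finally show "norm (F (f x)) \<le> norm (g x * \<bar>B\<bar>)" by simp
    qed
  qed (use meas in simp)
  have "f integrable_on UNIV"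
    using integrable_on_all_intervals_UNIV[of f g] int bd g has_integral_integral_lborel[OF g]
    by (auto simp: has_integral_integrable)
  then have "((\<lambda>x. F (f x)) has_integral F (integral UNIV f)) UNIV"
    using has_integral_linear[OF integrable_integral F] by (simp add: o_def)
  then show "F (integral UNIV f) = (LBINT x. F (f x))"
    using has_integral_integral_lborel[OF i] has_integral_unique by blast
qed

section \<open>The Fourier transform of a Gaussian and Plancherel's inequality\<close>

text \<open>
  This is the characteristic function of the standard normal distribution after scaling.
\<close>

lemma Fourier_gaussian:
  assumes "\<sigma> > 0"
  shows "integrable lborel (\<lambda>x. exp (- (\<sigma>\<^sup>2 * x\<^sup>2 / 2)) :: real)"
    and "(LBINT x. complex_of_real (exp (- (\<sigma>\<^sup>2 * x\<^sup>2 / 2))) * exp (\<i> * of_real (x * s)))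
           = of_real (2 * pi * normal_density 0 \<sigma> s)"
proof -
  have A: "exp (- (\<sigma>\<^sup>2 * x\<^sup>2 / 2)) = sqrt (2 * pi) / \<sigma> * normal_density 0 (1/\<sigma>) x" for x
    using assms by (simp add: normal_density_def real_sqrt_mult real_sqrt_divide field_simps)
  show "integrable lborel (\<lambda>x. exp (- (\<sigma>\<^sup>2 * x\<^sup>2 / 2)) :: real)"
    unfolding A using assms by simp
  have B: "(LBINT x. complex_of_real (std_normal_density x) * exp (\<i> * of_real (t * x))) = of_real (exp (- t\<^sup>2 / 2))" for t
    using fun_cong[OF char_std_normal_distribution, of t]
    by (simp add: char_def integral_density scaleR_conv_of_real cis_conv_exp mult.commute)
  have "(LBINT x. complex_of_real (exp (- (\<sigma>\<^sup>2 * x\<^sup>2 / 2))) * exp (\<i> * of_real (x * s)))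
     = \<bar>1/\<sigma>\<bar> *\<^sub>R (LBINT x. complex_of_real (exp (- (\<sigma>\<^sup>2 * (0 + 1/\<sigma> * x)\<^sup>2 / 2))) * exp (\<i> * of_real ((0 + 1/\<sigma> * x) * s)))"
    by (rule lborel_integral_real_affine) (use assms in simp)
  also have "(\<lambda>x. complex_of_real (exp (- (\<sigma>\<^sup>2 * (0 + 1/\<sigma> * x)\<^sup>2 / 2))) * exp (\<i> * of_real ((0 + 1/\<sigma> * x) * s)))
     = (\<lambda>x. of_real (sqrt (2*pi)) * (complex_of_real (std_normal_density x) * exp (\<i> * of_real ((s/\<sigma>) * x))))"
    using assms by (auto simp: std_normal_density_def power_divide power_mult_distrib mult_ac real_sqrt_mult fun_eq_iff)
  also have "(LBINT x. of_real (sqrt (2*pi)) * (complex_of_real (std_normal_density x) * exp (\<i> * of_real ((s/\<sigma>) * x))))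
     = of_real (sqrt (2*pi)) * of_real (exp (- (s/\<sigma>)\<^sup>2 / 2))"
    by (simp only: integral_mult_right_zero B)
  also have "\<bar>1/\<sigma>\<bar> *\<^sub>R (complex_of_real (sqrt (2*pi)) * of_real (exp (- (s/\<sigma>)\<^sup>2 / 2))) = of_real (2 * pi * normal_density 0 \<sigma> s)"
  proof -
    have "1/\<sigma> * (sqrt (2*pi) * exp (- (s/\<sigma>)\<^sup>2 / 2)) = 2 * pi * normal_density 0 \<sigma> s"
      using assms real_sqrt_pow2[of "2*pi"] by (simp add: normal_density_def real_sqrt_mult field_simps power2_eq_square)
    then show ?thesis using assms by (simp add: scaleR_conv_of_real flip: of_real_mult of_real_divide)
  qed
  finally show "(LBINT x. complex_of_real (exp (- (\<sigma>\<^sup>2 * x\<^sup>2 / 2))) * exp (\<i> * of_real (x * s)))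
           = of_real (2 * pi * normal_density 0 \<sigma> s)" .
qed

lemma integrable_tensor:
  fixes f g :: "real \<Rightarrow> real"
  assumes "integrable lborel f" "integrable lborel g"
  shows "integrable (lborel \<Otimes>\<^sub>M lborel) (\<lambda>(x, y). f x * g y)"
proof (rule lborel_pair.Fubini_integrable)
  have [measurable]: "f \<in> borel_measurable borel" "g \<in> borel_measurable borel"
    using assms by (auto dest: borel_measurable_integrable)
  show "(\<lambda>(x, y). f x * g y) \<in> borel_measurable (lborel \<Otimes>\<^sub>M lborel)" by measurable
  show "integrable lborel (\<lambda>x. LBINT y. norm (case (x, y) of (x, y) \<Rightarrow> f x * g y))"
    using assms by (simp add: abs_mult)
  show "AE x in lborel. integrable lborel (\<lambda>y. case (x, y) of (x, y) \<Rightarrow> f x * g y)"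
    using assms by simp
qed

text \<open>
  Half of Plancherel's theorem, for a Fourier transform \<open>v\<close> that is only given through its inner
  products. Expand \<open>(norm (v s))\<^sup>2\<close> as a double integral and integrate over \<open>s\<close> with a Gaussian weight.
  The weight turns into a positive kernel \<open>2 * pi * normal_density 0 \<sigma> (x - y)\<close> of mass \<open>2 * pi\<close> in each
  variable, so that by the inequality between arithmetic and geometric mean the result is at most
  \<open>2 * pi\<close> times the integral of \<open>g\<^sup>2\<close>, whatever the weight. Then let \<open>\<sigma>\<close> tend to \<open>0\<close>. The bound \<open>g0\<close>
  provides absolute convergence, and \<open>g\<close> the quantitative estimate.
\<close>

lemma Plancherel_inequality:
  fixes q v :: "real \<Rightarrow> 'a::complex_hilbert"
  assumes meas: "(\<lambda>(x, y). cinner (q x) (q y)) \<in> borel_measurable (lborel \<Otimes>\<^sub>M lborel)"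
    and g0: "\<And>x. norm (q x) \<le> g0 x" "integrable lborel g0"
    and g: "\<And>x. norm (q x) \<le> g x" "g \<in> borel_measurable borel" "integrable lborel (\<lambda>x. (g x)\<^sup>2)"
    and v: "\<And>s y. cinner (v s) y = (LBINT x. exp (- (\<i> * of_real (s * x))) * cinner (q x) y)"
  shows "integrable lborel (\<lambda>s. (norm (v s))\<^sup>2)"
    and "(LBINT s. (norm (v s))\<^sup>2) \<le> 2 * pi * (LBINT x. (g x)\<^sup>2)"
proof -
  define c where "c = (\<lambda>p. cinner (q (fst p)) (q (snd p)))"
  define e where "e = (\<lambda>s (p::real\<times>real). exp (- (\<i> * complex_of_real (s * (fst p - snd p)))))"
  define F where "F = (\<lambda>s. \<integral>p. e s p * c p \<partial>(lborel \<Otimes>\<^sub>M lborel))"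
  let ?L2 = "lborel \<Otimes>\<^sub>M lborel :: (real \<times> real) measure"
  have [measurable]: "g \<in> borel_measurable borel" by fact
  have [measurable]: "c \<in> borel_measurable (borel \<Otimes>\<^sub>M borel)"
    using meas by (simp add: c_def case_prod_beta' cong: measurable_cong_sets)
  have [measurable]: "(\<lambda>(s, p). e s p) \<in> borel_measurable (borel \<Otimes>\<^sub>M (borel \<Otimes>\<^sub>M borel))"
    unfolding e_def by measurable
  have e_split: "e s (x, y) = exp (- (\<i> * of_real (s * x))) * exp (\<i> * of_real (s * y))" for s x y
    by (simp add: e_def algebra_simps flip: exp_add)
  have e_swap: "e s p = exp (\<i> * of_real (s * (snd p - fst p)))" for s p
    by (simp add: e_def algebra_simps)
  have e1: "cmod (e s p) = 1" for s p by (simp add: e_def)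
  have c_le: "cmod (c p) \<le> g0 (fst p) * g0 (snd p)" for p
    unfolding c_def using norm_cinner_le order_trans[OF norm_ge_zero g0(1)]
    by (intro order_trans[OF norm_cinner_le] mult_mono g0) auto
  have int0: "integrable ?L2 (\<lambda>p. g0 (fst p) * g0 (snd p))"
    using integrable_tensor[OF g0(2) g0(2)] by (simp add: case_prod_beta')
  have int_ec: "integrable ?L2 (\<lambda>p. e s p * c p)" for s
  proof (rule Bochner_Integration.integrable_bound[OF int0])
    show "AE p in ?L2. cmod (e s p * c p) \<le> norm (g0 (fst p) * g0 (snd p))"
      using c_le by (auto simp: norm_mult e1 intro!: AE_I2 order_trans[OF c_le])
  qed measurable
  have F: "F s = of_real ((norm (v s))\<^sup>2)" for s
  proof -
    have "of_real ((norm (v s))\<^sup>2) = (LBINT x. exp (- (\<i> * of_real (s * x))) * cinner (q x) (v s))"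
      by (simp only: cinner_self[symmetric] v)
    also have "\<dots> = (LBINT x. LBINT y. e s (x, y) * c (x, y))"
    proof (rule Bochner_Integration.integral_cong[OF refl])
      fix x
      have "cinner (q x) (v s) = cnj (LBINT y. exp (- (\<i> * of_real (s * y))) * cinner (q y) (q x))"
        unfolding v[symmetric] by (rule cinner_commute)
      also have "\<dots> = (LBINT y. exp (\<i> * of_real (s * y)) * cinner (q x) (q y))"
        by (subst Bochner_Integration.integral_cnj[symmetric]) (simp add: exp_cnj cinner_commute[of "q x"])
      finally show "exp (- (\<i> * of_real (s * x))) * cinner (q x) (v s) = (LBINT y. e s (x, y) * c (x, y))"
        by (simp add: e_split c_def mult.assoc flip: integral_mult_right_zero)
    qed
    also have "\<dots> = F s"
      unfolding F_def using lborel_pair.integral_fst'[OF int_ec[of s]] by simp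
    finally show ?thesis by simp
  qed
  have [measurable]: "F \<in> borel_measurable borel"
    unfolding F_def by (measurable)
  have vm[measurable]: "(\<lambda>s. (norm (v s))\<^sup>2) \<in> borel_measurable borel"
  proof -
    have "(\<lambda>s. (norm (v s))\<^sup>2) = (\<lambda>s. Re (F s))" by (simp add: F)
    then show ?thesis by simp
  qed
  define G where "G = (LBINT x. (g x)\<^sup>2)"
  \<comment> \<open>The weighted inequality, with a bound independent of \<open>\<sigma>\<close>.\<close>
  have key: "(\<integral>\<^sup>+s. ennreal (exp (- (\<sigma>\<^sup>2 * s\<^sup>2 / 2)) * (norm (v s))\<^sup>2) \<partial>lborel) \<le> ennreal (2 * pi * G)"
    if \<sigma>: "\<sigma> > 0" for \<sigma> :: real
  proof -
    define w where "w = (\<lambda>s. exp (- (\<sigma>\<^sup>2 * s\<^sup>2 / 2)) :: real)"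
    interpret P: pair_sigma_finite "lborel :: real measure" ?L2 ..
    have [measurable]: "w \<in> borel_measurable borel" unfolding w_def by measurable
    have iw: "integrable lborel w" unfolding w_def by (rule Fourier_gaussian(1)[OF \<sigma>])
    have int3: "integrable (lborel \<Otimes>\<^sub>M ?L2) (\<lambda>(s, p). of_real (w s) * (e s p * c p))"
    proof (rule P.Fubini_integrable)
      show "(\<lambda>(s, p). of_real (w s) * (e s p * c p)) \<in> borel_measurable (lborel \<Otimes>\<^sub>M ?L2)" by measurable
      have "integrable ?L2 (\<lambda>p. cmod (c p))" using integrable_norm[OF int_ec[of 0]] by (simp add: e_def)
      then show "integrable lborel (\<lambda>s. \<integral>p. norm (case (s, p) of (s, p) \<Rightarrow> of_real (w s) * (e s p * c p)) \<partial>?L2)"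
        using iw by (simp add: norm_mult e1)
      show "AE s in lborel. integrable ?L2 (\<lambda>p. case (s, p) of (s, p) \<Rightarrow> of_real (w s) * (e s p * c p))"
        using int_ec by simp
    qed
    have intws: "integrable lborel (\<lambda>s. w s * (norm (v s))\<^sup>2)"
    proof -
      have "integrable lborel (\<lambda>s. of_real (w s) * F s)"
        using P.integrable_fst'[OF int3] by (simp add: F_def)
      then have "integrable lborel (\<lambda>s. Re (of_real (w s) * F s))" by (rule integrable_Re)
      then show ?thesis by (simp add: F)
    qed
    let ?n = "\<lambda>p::real\<times>real. 2 * pi * normal_density 0 \<sigma> (fst p - snd p)"
    have "of_real (LBINT s. w s * (norm (v s))\<^sup>2) = (LBINT s. of_real (w s) * F s)"
      unfolding F of_real_mult[symmetric] by (rule integral_complex_of_real[symmetric])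
    also have "\<dots> = (LBINT s. \<integral>p. of_real (w s) * (e s p * c p) \<partial>?L2)"
      by (simp add: F_def)
    also have "\<dots> = (\<integral>p. (LBINT s. of_real (w s) * (e s p * c p)) \<partial>?L2)"
      using P.Fubini_integral[OF int3] by simp
    also have "\<dots> = (\<integral>p. of_real (?n p) * c p \<partial>?L2)"
    proof (rule Bochner_Integration.integral_cong[OF refl])
      fix p :: "real \<times> real"
      have "(LBINT s. of_real (w s) * (e s p * c p)) = (LBINT s. of_real (w s) * exp (\<i> * of_real (s * (snd p - fst p)))) * c p"
        unfolding e_swap by (simp only: mult.assoc[symmetric] integral_mult_left_zero)
      also have "\<dots> = of_real (2 * pi * normal_density 0 \<sigma> (snd p - fst p)) * c p"
        unfolding w_def by (simp only: Fourier_gaussian(2)[OF \<sigma>])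
      also have "normal_density 0 \<sigma> (snd p - fst p) = normal_density 0 \<sigma> (fst p - snd p)"
        by (simp add: normal_density_def power2_commute)
      finally show "(LBINT s. of_real (w s) * (e s p * c p)) = of_real (?n p) * c p" .
    qed
    finally have eq: "of_real (LBINT s. w s * (norm (v s))\<^sup>2) = (\<integral>p. of_real (?n p) * c p \<partial>?L2)" .
    have "(\<integral>\<^sup>+s. ennreal (w s * (norm (v s))\<^sup>2) \<partial>lborel) = ennreal (LBINT s. w s * (norm (v s))\<^sup>2)"
      using intws by (intro nn_integral_eq_integral) (auto simp: w_def)
    also have "\<dots> \<le> ennreal (cmod (of_real (LBINT s. w s * (norm (v s))\<^sup>2)))"
      by (intro ennreal_leI) simp
    also have "\<dots> \<le> (\<integral>\<^sup>+p. ennreal (cmod (of_real (?n p) * c p)) \<partial>?L2)"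
      unfolding eq
      by (cases "integrable ?L2 (\<lambda>p. of_real (?n p) * c p)")
        (auto intro!: integral_norm_bound_ennreal simp: not_integrable_integral_eq)
    also have "\<dots> \<le> (\<integral>\<^sup>+p. (ennreal (pi * (g (fst p))\<^sup>2) * ennreal (normal_density 0 \<sigma> (fst p - snd p))
          + ennreal (pi * (g (snd p))\<^sup>2) * ennreal (normal_density 0 \<sigma> (fst p - snd p))) \<partial>?L2)"
    proof (rule nn_integral_mono)
      fix p :: "real \<times> real"
      have "cmod (c p) \<le> g (fst p) * g (snd p)"
        unfolding c_def using order_trans[OF norm_ge_zero g(1)]
        by (intro order_trans[OF norm_cinner_le] mult_mono g) auto
      also have "\<dots> \<le> ((g (fst p))\<^sup>2 + (g (snd p))\<^sup>2) / 2"
        using sum_squares_bound[of "g (fst p)" "g (snd p)"] by simp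
      finally have "?n p * cmod (c p) \<le> ?n p * (((g (fst p))\<^sup>2 + (g (snd p))\<^sup>2) / 2)"
        by (intro mult_left_mono) auto
      then show "ennreal (cmod (of_real (?n p) * c p)) \<le> ennreal (pi * (g (fst p))\<^sup>2) * ennreal (normal_density 0 \<sigma> (fst p - snd p))
          + ennreal (pi * (g (snd p))\<^sup>2) * ennreal (normal_density 0 \<sigma> (fst p - snd p))"
        by (simp add: norm_mult algebra_simps flip: ennreal_mult ennreal_plus)
    qed
    also have "\<dots> = (\<integral>\<^sup>+p. ennreal (pi * (g (fst p))\<^sup>2) * ennreal (normal_density 0 \<sigma> (fst p - snd p)) \<partial>?L2)
          + (\<integral>\<^sup>+p. ennreal (pi * (g (snd p))\<^sup>2) * ennreal (normal_density 0 \<sigma> (fst p - snd p)) \<partial>?L2)"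
      by (rule nn_integral_add) measurable
    also have "(\<integral>\<^sup>+p. ennreal (pi * (g (fst p))\<^sup>2) * ennreal (normal_density 0 \<sigma> (fst p - snd p)) \<partial>?L2)
        = (\<integral>\<^sup>+x. \<integral>\<^sup>+y. ennreal (pi * (g x)\<^sup>2) * ennreal (normal_density 0 \<sigma> (x - y)) \<partial>lborel \<partial>lborel)"
      by (subst lborel.nn_integral_fst[symmetric]) simp_all
    also have "\<dots> = (\<integral>\<^sup>+x. ennreal (pi * (g x)\<^sup>2) \<partial>lborel)"
    proof (rule nn_integral_cong)
      fix x
      have "(\<integral>\<^sup>+y. ennreal (normal_density 0 \<sigma> (x - y)) \<partial>lborel) = (\<integral>\<^sup>+y. ennreal (normal_density x \<sigma> y) \<partial>lborel)"
        by (simp add: normal_density_def power2_commute)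
      also have "\<dots> = 1" using \<sigma> by (simp add: nn_integral_eq_integral)
      finally show "(\<integral>\<^sup>+y. ennreal (pi * (g x)\<^sup>2) * ennreal (normal_density 0 \<sigma> (x - y)) \<partial>lborel) = ennreal (pi * (g x)\<^sup>2)"
        by (simp add: nn_integral_cmult)
    qed
    also have "(\<integral>\<^sup>+p. ennreal (pi * (g (snd p))\<^sup>2) * ennreal (normal_density 0 \<sigma> (fst p - snd p)) \<partial>?L2)
        = (\<integral>\<^sup>+y. \<integral>\<^sup>+x. ennreal (pi * (g y)\<^sup>2) * ennreal (normal_density 0 \<sigma> (x - y)) \<partial>lborel \<partial>lborel)"
      by (subst lborel_pair.nn_integral_snd[symmetric]) (simp_all add: case_prod_beta')
    also have "\<dots> = (\<integral>\<^sup>+x. ennreal (pi * (g x)\<^sup>2) \<partial>lborel)"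
    proof (rule nn_integral_cong)
      fix x
      have "(\<integral>\<^sup>+y. ennreal (normal_density 0 \<sigma> (y - x)) \<partial>lborel) = (\<integral>\<^sup>+y. ennreal (normal_density x \<sigma> y) \<partial>lborel)"
        by (simp add: normal_density_def)
      also have "\<dots> = 1" using \<sigma> by (simp add: nn_integral_eq_integral)
      finally show "(\<integral>\<^sup>+y. ennreal (pi * (g x)\<^sup>2) * ennreal (normal_density 0 \<sigma> (y - x)) \<partial>lborel) = ennreal (pi * (g x)\<^sup>2)"
        by (simp add: nn_integral_cmult)
    qed
    also have "(\<integral>\<^sup>+x. ennreal (pi * (g x)\<^sup>2) \<partial>lborel) = ennreal (pi * G)"
      using g(3) by (subst nn_integral_eq_integral) (auto simp: G_def)
    also have "ennreal (pi * G) + ennreal (pi * G) = ennreal (2 * pi * G)"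
      by (subst ennreal_plus[symmetric]) (auto simp: G_def)
    finally show ?thesis by (simp add: w_def)
  qed
  \<comment> \<open>Removing the weight along \<open>\<sigma> = 1 / Suc n\<close> by Fatou's lemma.\<close>
  define W where "W = (\<lambda>n s. exp (- ((1 / real (Suc n))\<^sup>2 * s\<^sup>2 / 2)) * (norm (v s))\<^sup>2)"
  have Wlim: "(\<lambda>n. ennreal (W n s)) \<longlonglongrightarrow> ennreal ((norm (v s))\<^sup>2)" for s
  proof -
    have "(\<lambda>n. W n s) \<longlonglongrightarrow> exp (- (0\<^sup>2 * s\<^sup>2 / 2)) * (norm (v s))\<^sup>2"
      unfolding W_def by (intro tendsto_intros LIMSEQ_Suc[OF lim_1_over_n]) auto
    then show ?thesis by (intro tendsto_ennrealI) simp
  qed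
  have bound: "(\<integral>\<^sup>+s. ennreal ((norm (v s))\<^sup>2) \<partial>lborel) \<le> ennreal (2 * pi * G)"
  proof -
    have "(\<integral>\<^sup>+s. ennreal ((norm (v s))\<^sup>2) \<partial>lborel) = (\<integral>\<^sup>+s. liminf (\<lambda>n. ennreal (W n s)) \<partial>lborel)"
      by (intro nn_integral_cong lim_imp_Liminf[symmetric] Wlim) simp
    also have "\<dots> \<le> liminf (\<lambda>n. \<integral>\<^sup>+s. ennreal (W n s) \<partial>lborel)"
      by (rule nn_integral_liminf) (simp add: W_def)
    also have "\<dots> \<le> liminf (\<lambda>n. ennreal (2 * pi * G))"
      by (intro Liminf_mono always_eventually allI) (simp add: W_def key)
    finally show ?thesis by (simp add: Liminf_const)
  qed
  show i: "integrable lborel (\<lambda>s. (norm (v s))\<^sup>2)"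
    using bound by (intro integrableI_bounded) (auto simp: le_less_trans[OF bound ennreal_less_top])
  have "G \<ge> 0" by (simp add: G_def)
  then show "(LBINT s. (norm (v s))\<^sup>2) \<le> 2 * pi * (LBINT x. (g x)\<^sup>2)"
    using bound nn_integral_eq_integral[OF i] by (simp add: G_def)
qed

section \<open>Bounded semigroups with resolvent on the imaginary axis\<close>

lemma has_bochner_integral_power_exp:
  assumes "a > (0::real)"
  shows "has_bochner_integral lborel (\<lambda>s. indicator {0..} s * (s ^ n * exp (- (a * s)))) (fact n / a ^ (n + 1))"
proof -
  define f where "f = (\<lambda>x::real. x ^ n * exp (- x) * indicator {0..} x)"
  have "has_bochner_integral lborel f (fact n)"
    unfolding f_def by (rule has_bochner_integral_I0i_power_exp_m')
  then have "has_bochner_integral lborel (\<lambda>x. f (0 + a * x)) (fact n /\<^sub>R \<bar>a\<bar>)"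
    using lborel_has_bochner_integral_real_affine_iff[of a f "fact n" 0] assms by blast
  from has_bochner_integral_mult_right[OF this, of "1 / a ^ n"]
  have "has_bochner_integral lborel (\<lambda>s. 1 / a ^ n * f (0 + a * s)) (1 / a ^ n * (fact n /\<^sub>R \<bar>a\<bar>))" by blast
  moreover have "(\<lambda>s. 1 / a ^ n * f (0 + a * s))
      = (\<lambda>s. indicator {0..} s * (s ^ n * exp (- (a * s))))"
    using assms by (auto simp: fun_eq_iff f_def indicator_def zero_le_mult_iff power_mult_distrib)
  moreover have "1 / a ^ n * (fact n /\<^sub>R \<bar>a\<bar>) = fact n / a ^ (n + 1)"
    using assms by (simp add: divide_simps)
  ultimately show ?thesis by (simp only:)
qed

text \<open>
  The fundamental theorem of calculus on a half-line, with a one-sided derivative at \<open>0\<close>, which is all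
  that an orbit of a semigroup has.
\<close>

lemma integral_halfline_derivative:
  fixes F f :: "real \<Rightarrow> complex"
  assumes F: "\<And>s. 0 \<le> s \<Longrightarrow> (F has_vector_derivative f s) (at s within {0..})"
    and f: "continuous_on {0..} f" "integrable lborel (\<lambda>s. indicator {0..} s *\<^sub>R f s)"
    and lim: "(F \<longlongrightarrow> 0) at_top"
  shows "(LBINT s. indicator {0..} s *\<^sub>R f s) = - F 0"
proof (rule tendsto_unique[OF trivial_limit_at_top_linorder])
  show "((\<lambda>b. LBINT s. indicator {..b} s *\<^sub>R (indicator {0..} s *\<^sub>R f s)) \<longlongrightarrow> (LBINT s. indicator {0..} s *\<^sub>R f s)) at_top"
    by (rule tendsto_integral_at_top) (use f in auto)
  have "(LBINT s. indicator {..b} s *\<^sub>R (indicator {0..} s *\<^sub>R f s)) = F b - F 0" if "b \<ge> 0" for b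
  proof -
    have "(LBINT s. indicator {..b} s *\<^sub>R (indicator {0..} s *\<^sub>R f s)) = (LBINT s. indicator {0..b} s *\<^sub>R f s)"
      by (rule Bochner_Integration.integral_cong) (auto simp: indicator_def)
    also have "\<dots> = F b - F 0"
      by (rule integral_FTC_atLeastAtMost[OF that])
       (auto intro: has_vector_derivative_within_subset[OF F] continuous_on_subset[OF f(1)])
    finally show ?thesis .
  qed
  then have "\<forall>\<^sub>F b in at_top. (LBINT s. indicator {..b} s *\<^sub>R (indicator {0..} s *\<^sub>R f s)) = F b - F 0"
    by (auto simp: eventually_at_top_linorder)
  moreover have "((\<lambda>b. F b - F 0) \<longlongrightarrow> 0 - F 0) at_top" by (intro tendsto_intros lim)
  ultimately show "((\<lambda>b. LBINT s. indicator {..b} s *\<^sub>R (indicator {0..} s *\<^sub>R f s)) \<longlongrightarrow> - F 0) at_top"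
    by (simp add: tendsto_cong)
qed

text \<open>
  \<open>S \<xi>\<close> stands for the inverse of \<open>\<i> * \<xi> + A\<close>; in particular \<open>S 0\<close> is the inverse of \<open>A\<close>.
\<close>

locale imaginary_resolvent_semigroup =
  fixes T :: "real \<Rightarrow> 'a::complex_hilbert \<Rightarrow> 'a" and D :: "'a set" and A :: "'a \<Rightarrow> 'a" and K :: real
    and S :: "real \<Rightarrow> 'a \<Rightarrow> 'a"
  assumes C0: "C0_semigroup T" and generator: "is_generator T D (\<lambda>x. - A x)"
    and K_ge_1: "K \<ge> 1" and norm_T_le: "0 \<le> t \<Longrightarrow> norm (T t x) \<le> K * norm x"
    and S_bounded: "bounded_clinear (S \<xi>)"
    and S_in_D: "S \<xi> u \<in> D" and S_right: "(\<i> * of_real \<xi>) *\<^sub>C S \<xi> u + A (S \<xi> u) = u"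
    and S_left: "x \<in> D \<Longrightarrow> S \<xi> ((\<i> * of_real \<xi>) *\<^sub>C x + A x) = x"
begin

lemma bounded_linear_T: "0 \<le> t \<Longrightarrow> bounded_linear (T t)"
  and T_scaleC: "0 \<le> t \<Longrightarrow> T t (c *\<^sub>C x) = c *\<^sub>C T t x"
  and T_0: "T 0 x = x"
  and T_add: "0 \<le> s \<Longrightarrow> 0 \<le> t \<Longrightarrow> T (s + t) x = T s (T t x)"
  and T_right_continuous: "((\<lambda>t. T t x) \<longlongrightarrow> x) (at_right 0)"
  using C0 by (auto simp: C0_semigroup_def bounded_clinear_def)

lemmas T_diff = linear_diff[OF bounded_linear.linear[OF bounded_linear_T]]
lemmas T_plus = linear_add[OF bounded_linear.linear[OF bounded_linear_T]]

lemma T_shift_le: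
  assumes "0 \<le> s" "0 \<le> r"
  shows "norm (T s x - T r x) \<le> K * norm (T \<bar>s - r\<bar> x - x)"
proof -
  have *: "norm (T s x - T r x) \<le> K * norm (T \<bar>s - r\<bar> x - x)" if "0 \<le> r" "r \<le> s" for s r
  proof -
    have "T s x - T r x = T r (T (s - r) x - x)"
      using that T_add[of r "s - r" x] by (simp add: T_diff)
    then show ?thesis using that norm_T_le[of r "T (s - r) x - x"] by simp
  qed
  show ?thesis
    using *[of r s] *[of s r] assms by (cases "r \<le> s") (auto simp: norm_minus_commute abs_minus_commute)
qed

lemma T_near_0: "((\<lambda>h. T \<bar>h\<bar> x - x) \<longlongrightarrow> 0) (at 0)"
proof -
  have "((\<lambda>h::real. \<bar>h\<bar>) \<longlongrightarrow> \<bar>0\<bar>) (at 0)" by (intro tendsto_intros)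
  then have "filterlim (\<lambda>h::real. \<bar>h\<bar>) (at_right 0) (at 0)"
    by (simp add: filterlim_at eventually_at_filter)
  from filterlim_compose[OF T_right_continuous this]
  have "((\<lambda>h. T \<bar>h\<bar> x) \<longlongrightarrow> x) (at 0)" .
  then show ?thesis by (rule LIM_zero)
qed

lemma T_shift_tendsto: "((\<lambda>r. T \<bar>r - s\<bar> x - x) \<longlongrightarrow> 0) (at s within X)"
proof -
  have "((\<lambda>r. r - s) \<longlongrightarrow> s - s) (at s within X)" by (intro tendsto_intros)
  then have "filterlim (\<lambda>r. r - s) (at 0) (at s within X)"
    by (simp add: filterlim_at eventually_at_filter)
  from filterlim_compose[OF T_near_0 this] show ?thesis .
qed

lemma continuous_on_T: "continuous_on {0..} (\<lambda>s. T s x)"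
  unfolding continuous_on_def
proof
  fix s :: real assume s: "s \<in> {0..}"
  have "((\<lambda>r. T r x - T s x) \<longlongrightarrow> 0) (at s within {0..})"
  proof (rule Lim_null_comparison)
    show "((\<lambda>r. K * norm (T \<bar>r - s\<bar> x - x)) \<longlongrightarrow> 0) (at s within {0..})"
      by (intro tendsto_mult_right_zero tendsto_norm_zero T_shift_tendsto)
    show "\<forall>\<^sub>F r in at s within {0..}. norm (T r x - T s x) \<le> K * norm (T \<bar>r - s\<bar> x - x)"
      unfolding eventually_at_filter using s by (intro always_eventually allI impI T_shift_le) auto
  qed
  then show "((\<lambda>r. T r x) \<longlongrightarrow> T s x) (at s within {0..})" by (rule LIM_zero_cancel)
qed

text \<open>
  Joint continuity is what makes the integrands below measurable in both variables. The absolute value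
  extends the orbit continuously to negative times.
\<close>

lemma continuous_T_jointly:
  assumes "continuous_on UNIV p"
  shows "continuous_on UNIV (\<lambda>(s, \<xi>). T \<bar>s\<bar> (p (\<xi>::real)))"
  unfolding continuous_on_def
proof (clarsimp simp: split_beta')
  fix s \<xi> :: real
  let ?F = "at (s, \<xi>)"
  have fs: "((\<lambda>x. \<bar>fst x\<bar>) \<longlongrightarrow> \<bar>fst (s, \<xi>)\<bar>) ?F" and sn: "(snd \<longlongrightarrow> snd (s, \<xi>)) ?F"
    by (intro tendsto_intros)+
  have p: "((\<lambda>x. p (snd x)) \<longlongrightarrow> p \<xi>) ?F"
    using continuous_on_tendsto_compose[OF assms sn] by simp
  have 1: "((\<lambda>x. T \<bar>fst x\<bar> (p \<xi>)) \<longlongrightarrow> T \<bar>s\<bar> (p \<xi>)) ?F"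
    using continuous_on_tendsto_compose[OF continuous_on_T[of "p \<xi>"] fs] by simp
  have 2: "((\<lambda>x. T \<bar>fst x\<bar> (p (snd x) - p \<xi>)) \<longlongrightarrow> 0) ?F"
  proof (rule Lim_null_comparison)
    show "((\<lambda>x. K * norm (p (snd x) - p \<xi>)) \<longlongrightarrow> 0) ?F"
      using p by (intro tendsto_mult_right_zero tendsto_norm_zero LIM_zero)
    show "\<forall>\<^sub>F x in ?F. norm (T \<bar>fst x\<bar> (p (snd x) - p \<xi>)) \<le> K * norm (p (snd x) - p \<xi>)"
      by (intro always_eventually allI norm_T_le) (rule abs_ge_zero)
  qed
  have "T \<bar>fst x\<bar> (p \<xi>) + T \<bar>fst x\<bar> (p (snd x) - p \<xi>) = T \<bar>fst x\<bar> (p (snd x))" for x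
    by (subst T_plus[symmetric]) simp_all
  with tendsto_add[OF 1 2] show "((\<lambda>x. T \<bar>fst x\<bar> (p (snd x))) \<longlongrightarrow> T \<bar>s\<bar> (p \<xi>)) ?F"
    by simp
qed

lemma generator_limit: "x \<in> D \<Longrightarrow> ((\<lambda>h. (T h x - x) /\<^sub>R h) \<longlongrightarrow> - A x) (at_right 0)"
  using generator unfolding is_generator_def by blast

text \<open>
  The generator only provides the right derivative at \<open>0\<close>. The semigroup law transports it to \<open>s\<close>, and
  for the left derivative strong continuity at \<open>s\<close> enters in addition; the error on both sides is
  controlled by the same function of \<open>\<bar>r - s\<bar>\<close>.
\<close>

lemma T_derivative:
  assumes x: "x \<in> D" and s: "0 \<le> s"
  shows "((\<lambda>r. T r x) has_vector_derivative - T s (A x)) (at s within {0..})"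
proof -
  define d where "d = (\<lambda>h. (T h x - x) /\<^sub>R h + A x)"
  have d0: "((\<lambda>r. d \<bar>r - s\<bar>) \<longlongrightarrow> 0) (at s within {0..})"
  proof (rule filterlim_compose[of d "nhds 0" "at_right 0" "\<lambda>r. \<bar>r - s\<bar>" "at s within {0..}"])
    show "(d \<longlongrightarrow> 0) (at_right 0)"
      using tendsto_add[OF generator_limit[OF x] tendsto_const[of "A x"]] unfolding d_def by simp
    have "((\<lambda>r. \<bar>r - s\<bar>) \<longlongrightarrow> 0) (at s within {0..})"
      by (rule tendsto_eq_intros tendsto_ident_at refl | simp)+
    then show "filterlim (\<lambda>r. \<bar>r - s\<bar>) (at_right 0) (at s within {0..})"
      by (simp add: filterlim_at eventually_at_filter)
  qed
  have est: "norm ((1 / norm (r - s)) *\<^sub>R (T r x - (T s x + (r - s) *\<^sub>R - T s (A x))))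
      \<le> K * norm (d \<bar>r - s\<bar>) + K * norm (T \<bar>r - s\<bar> (A x) - A x)" if r: "0 \<le> r" "r \<noteq> s" for r
  proof (cases "s < r")
    case True
    have "(1 / norm (r - s)) *\<^sub>R (T r x - (T s x + (r - s) *\<^sub>R - T s (A x))) = T s (d (r - s))"
      using True s T_add[of s "r - s" x]
      by (simp add: d_def T_plus T_diff linear_scale[OF bounded_linear.linear[OF bounded_linear_T]] scaleR_right_diff_distrib scaleR_right_distrib divide_inverse)
    then show ?thesis using True norm_T_le[OF s, of "d (r - s)"] K_ge_1 by (simp add: add_increasing2)
  next
    case False
    then have rs: "r < s" using r by simp
    then have inv: "inverse (s - r) * (r - s) = - 1" by (simp add: field_simps)
    have "(1 / norm (r - s)) *\<^sub>R (T r x - (T s x + (r - s) *\<^sub>R - T s (A x)))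
        = T r (A x) - T s (A x) - T r (d (s - r))"
      using rs r T_add[of r "s - r" x] inv
      by (simp add: d_def T_plus T_diff linear_scale[OF bounded_linear.linear[OF bounded_linear_T]] scaleR_right_diff_distrib scaleR_right_distrib divide_inverse)
    also have "norm \<dots> \<le> norm (T r (A x) - T s (A x)) + norm (T r (d (s - r)))"
      by (rule norm_triangle_ineq4)
    also have "\<dots> \<le> K * norm (T \<bar>r - s\<bar> (A x) - A x) + K * norm (d \<bar>r - s\<bar>)"
      using rs r s norm_T_le[of r "d (s - r)"] by (intro add_mono T_shift_le) auto
    finally show ?thesis by simp
  qed
  have lim: "((\<lambda>r. K * norm (d \<bar>r - s\<bar>) + K * norm (T \<bar>r - s\<bar> (A x) - A x)) \<longlongrightarrow> K * norm (0::'a) + K * norm (0::'a)) (at s within {0..})"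
    by (intro tendsto_intros d0 T_shift_tendsto)
  show ?thesis
    unfolding has_vector_derivative_def has_derivative_within
  proof
    show "bounded_linear (\<lambda>h. h *\<^sub>R - T s (A x))" by (rule bounded_linear_scaleR_left)
    show "((\<lambda>r. (1 / norm (r - s)) *\<^sub>R (T r x - (T s x + (r - s) *\<^sub>R - T s (A x)))) \<longlongrightarrow> 0) (at s within {0..})"
      by (rule Lim_null_comparison[OF _ lim[simplified]]) (use est in \<open>auto simp: eventually_at_filter\<close>)
  qed
qed


lemma T_in_D: "x \<in> D \<Longrightarrow> 0 \<le> s \<Longrightarrow> T s x \<in> D"
  and A_T: "x \<in> D \<Longrightarrow> 0 \<le> s \<Longrightarrow> A (T s x) = T s (A x)"
proof -
  assume x: "x \<in> D" and s: "0 \<le> s"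
  have "((\<lambda>h. T s ((T h x - x) /\<^sub>R h)) \<longlongrightarrow> T s (- A x)) (at_right 0)"
    by (rule bounded_linear.tendsto[OF bounded_linear_T[OF s] generator_limit[OF x]])
  then have lim: "((\<lambda>h. (T h (T s x) - T s x) /\<^sub>R h) \<longlongrightarrow> T s (- A x)) (at_right 0)"
  proof (rule Lim_transform_eventually)
    show "\<forall>\<^sub>F h in at_right 0. T s ((T h x - x) /\<^sub>R h) = (T h (T s x) - T s x) /\<^sub>R h"
      using s T_add[of s _ x] T_add[of _ s x]
      by (auto simp: eventually_at_filter T_diff linear_scale[OF bounded_linear.linear[OF bounded_linear_T]] add.commute
          intro!: always_eventually)
  qed
  show "T s x \<in> D" using generator lim unfolding is_generator_def by blast
  then have "- A (T s x) = T s (- A x)"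
    using tendsto_unique[OF _ generator_limit lim] by simp
  then show "A (T s x) = T s (A x)"
    using linear_neg[OF bounded_linear.linear[OF bounded_linear_T[OF s]]] by simp
qed

lemma A_S0: "A (S 0 x) = x"
  using S_right[of 0 x] scaleC_add_left[of 0 0 "S 0 x"] by simp

lemma bounded_linear_S: "bounded_linear (S \<xi>)"
  using S_bounded by (simp add: bounded_clinear_def)

lemma S_scaleC: "S \<xi> (c *\<^sub>C x) = c *\<^sub>C S \<xi> x"
  using S_bounded by (simp add: bounded_clinear_def)

lemma S_T_commute:
  assumes "0 \<le> s" shows "S \<xi> (T s u) = T s (S \<xi> u)"
proof -
  have "T s u = T s ((\<i> * of_real \<xi>) *\<^sub>C S \<xi> u + A (S \<xi> u))" by (simp only: S_right)
  also have "\<dots> = (\<i> * of_real \<xi>) *\<^sub>C T s (S \<xi> u) + A (T s (S \<xi> u))"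
    using assms by (simp add: T_plus T_scaleC A_T S_in_D)
  finally show ?thesis using S_left[OF T_in_D[OF S_in_D assms]] by simp
qed

section \<open>The resolvent in the right half-plane as a Laplace transform\<close>

text \<open>
  Extended by zero, the damped orbit is a function on the whole line to which Plancherel applies.
\<close>

definition lap_orbit :: "complex \<Rightarrow> 'a \<Rightarrow> real \<Rightarrow> 'a" where
  "lap_orbit z x s = indicator {0..} s *\<^sub>R (exp (- (z * of_real s)) *\<^sub>C T s x)"

definition laplace :: "complex \<Rightarrow> 'a \<Rightarrow> 'a" where
  "laplace z x = integral UNIV (lap_orbit z x)"

lemma continuous_on_weighted_orbit: "continuous_on {0..} (\<lambda>s. exp (- (z * of_real s)) *\<^sub>C T s x)"
  by (intro bounded_bilinear.continuous_on[OF bounded_bilinear_scaleC] continuous_intros continuous_on_T)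

lemma norm_lap_orbit_le: "norm (lap_orbit z x s) \<le> indicator {0..} s * (K * norm x * exp (- (Re z * s)))"
  using mult_left_mono[OF norm_T_le[of s x], of "exp (- (Re z * s))"]
  by (auto simp: lap_orbit_def indicator_def norm_scaleC mult_ac)

lemma integrable_orbit_bound:
  assumes "a > (0::real)" shows "integrable lborel (\<lambda>s. indicator {0..} s * (c * exp (- (a * s))))"
  using integrable_mult_right[OF has_bochner_integral_power_exp[OF assms, of 0, THEN integrable.intros], of c]
  by (simp add: mult_ac)

lemma lap_orbit_integrable_on: "lap_orbit z x integrable_on {a..b}"
proof -
  have "(\<lambda>s. exp (- (z * of_real s)) *\<^sub>C T s x) integrable_on {max 0 a..b}"
    by (intro integrable_continuous_interval continuous_on_subset[OF continuous_on_weighted_orbit]) auto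
  then have "(\<lambda>s. if s \<in> {0..} then exp (- (z * of_real s)) *\<^sub>C T s x else 0) integrable_on {a..b}"
    by (subst integrable_restrict_Int) (auto simp: Int_atLeastAtMost max_def elim!: back_subst[of "\<lambda>S. _ integrable_on S"])
  then show ?thesis
    by (rule integrable_eq) (auto simp: lap_orbit_def)
qed

lemma laplace_functional:
  assumes "Re z > 0" "bounded_linear (F :: 'a \<Rightarrow> complex)"
  shows "integrable lborel (\<lambda>s. F (lap_orbit z x s))" "F (laplace z x) = (LBINT s. F (lap_orbit z x s))"
proof -
  have "(\<lambda>s. F (lap_orbit z x s)) = (\<lambda>s. indicator {0..} s *\<^sub>R F (exp (- (z * of_real s)) *\<^sub>C T s x))"
    using assms(2) by (auto simp: lap_orbit_def indicator_def linear_0 bounded_linear.linear)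
  moreover have "(\<lambda>s. indicator {0..} s *\<^sub>R F (exp (- (z * of_real s)) *\<^sub>C T s x)) \<in> borel_measurable borel"
    by (intro borel_measurable_continuous_on_indicator bounded_linear.continuous_on[OF assms(2)] continuous_on_weighted_orbit) auto
  ultimately have m: "(\<lambda>s. F (lap_orbit z x s)) \<in> borel_measurable borel" by simp
  note * = lap_orbit_integrable_on norm_lap_orbit_le integrable_orbit_bound[OF assms(1)] assms(2) m
  show "integrable lborel (\<lambda>s. F (lap_orbit z x s))" "F (laplace z x) = (LBINT s. F (lap_orbit z x s))"
    using weak_integral_dominated[OF *] by (auto simp: laplace_def)
qed

lemma cinner_laplace:
  assumes "Re z > 0"
  shows "integrable lborel (\<lambda>s. indicator {0..} s *\<^sub>R (exp (- (z * of_real s)) * cinner (T s x) y))"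
    and "cinner (laplace z x) y = (LBINT s. indicator {0..} s *\<^sub>R (exp (- (z * of_real s)) * cinner (T s x) y))"
proof -
  have "(\<lambda>s. cinner (lap_orbit z x s) y) = (\<lambda>s. indicator {0..} s *\<^sub>R (exp (- (z * of_real s)) * cinner (T s x) y))"
    by (auto simp: lap_orbit_def indicator_def cinner_simps)
  then show "integrable lborel (\<lambda>s. indicator {0..} s *\<^sub>R (exp (- (z * of_real s)) * cinner (T s x) y))"
    "cinner (laplace z x) y = (LBINT s. indicator {0..} s *\<^sub>R (exp (- (z * of_real s)) * cinner (T s x) y))"
    using laplace_functional[OF assms bounded_linear_cinner_left, of x y] by simp_all
qed

end

lemma power_times_exp_tendsto_0:
  assumes "a > (0::real)" shows "((\<lambda>s. s ^ n * exp (- (a * s))) \<longlongrightarrow> 0) at_top"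
proof -
  have "filterlim (\<lambda>s. a * s) at_top at_top"
    using assms by (intro filterlim_tendsto_pos_mult_at_top[OF tendsto_const] filterlim_ident)
  from filterlim_compose[OF tendsto_power_div_exp_0 this, of n]
  have "((\<lambda>s. (1 / a ^ n) * ((a * s) ^ n / exp (a * s))) \<longlongrightarrow> (1 / a ^ n) * 0) at_top"
    by (intro tendsto_intros)
  moreover have "(1 / a ^ n) * ((a * s) ^ n / exp (a * s)) = s ^ n * exp (- (a * s))" for s
    using assms by (simp add: power_mult_distrib exp_minus divide_inverse)
  ultimately show ?thesis by simp
qed

context imaginary_resolvent_semigroup
begin

text \<open>
  The Laplace transform of \<open>s ^ n * T s x\<close>, tested against \<open>y\<close>; by repeated integration by parts
  it is \<open>fact n\<close> times a power of the resolvent (\<open>weak_lap_eq_power\<close>).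
\<close>

definition weak_lap :: "nat \<Rightarrow> complex \<Rightarrow> 'a \<Rightarrow> 'a \<Rightarrow> complex" where
  "weak_lap n z x y =
     (LBINT s. indicator {0..} s *\<^sub>R (of_real (s ^ n) * exp (- (z * of_real s)) * cinner (T s x) y))"

lemma norm_weighted_orbit_le:
  "0 \<le> s \<Longrightarrow> cmod (of_real (s ^ n) * exp (- (z * of_real s)) * cinner (T s x) y)
     \<le> K * norm x * norm y * (s ^ n * exp (- (Re z * s)))"
proof -
  assume s: "0 \<le> s"
  have "cmod (cinner (T s x) y) \<le> K * norm x * norm y"
    using order_trans[OF norm_cinner_le mult_right_mono[OF norm_T_le[OF s]]] by simp
  from mult_left_mono[OF this, of "s ^ n * exp (- (Re z * s))"] s
  show ?thesis by (simp add: norm_mult mult_ac norm_power)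
qed

lemma continuous_on_cinner_T: "continuous_on {0..} (\<lambda>s. cinner (T s x) y)"
  by (intro bounded_linear.continuous_on[OF bounded_linear_cinner_left] continuous_on_T)

lemma weak_lap_integrable:
  assumes "Re z > 0"
  shows "integrable lborel (\<lambda>s. indicator {0..} s *\<^sub>R (of_real (s ^ n) * exp (- (z * of_real s)) * cinner (T s x) y))"
proof (rule Bochner_Integration.integrable_bound)
  show "integrable lborel (\<lambda>s. K * norm x * norm y * (indicator {0..} s * (s ^ n * exp (- (Re z * s)))))"
    using has_bochner_integral_power_exp[OF assms, of n] by (intro integrable_mult_right) (auto dest: integrable.intros)
  have "(\<lambda>s. indicator {0..} s *\<^sub>R (of_real (s ^ n) * exp (- (z * of_real s)) * cinner (T s x) y)) \<in> borel_measurable borel"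
    by (intro borel_measurable_continuous_on_indicator continuous_intros continuous_on_cinner_T) auto
  then show "(\<lambda>s. indicator {0..} s *\<^sub>R (of_real (s ^ n) * exp (- (z * of_real s)) * cinner (T s x) y)) \<in> borel_measurable lborel"
    by simp
  show "AE s in lborel. norm (indicator {0..} s *\<^sub>R (of_real (s ^ n) * exp (- (z * of_real s)) * cinner (T s x) y))
     \<le> norm (K * norm x * norm y * (indicator {0..} s * (s ^ n * exp (- (Re z * s)))))"
  proof (rule AE_I2)
    fix s :: real
    show "norm (indicator {0..} s *\<^sub>R (of_real (s ^ n) * exp (- (z * of_real s)) * cinner (T s x) y))
     \<le> norm (K * norm x * norm y * (indicator {0..} s * (s ^ n * exp (- (Re z * s)))))"
      using norm_weighted_orbit_le[of s n z x y] abs_ge_self order_trans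
      by (cases "0 \<le> s") (auto simp: indicator_def intro: order_trans)
  qed
qed

lemma cinner_laplace_eq: "Re z > 0 \<Longrightarrow> cinner (laplace z x) y = weak_lap 0 z x y"
  by (simp add: cinner_laplace weak_lap_def)

lemma weak_lap_linear:
  assumes "Re z > 0"
  shows "weak_lap n z (x + x') y = weak_lap n z x y + weak_lap n z x' y"
    and "weak_lap n z (c *\<^sub>C x) y = c * weak_lap n z x y"
proof -
  have "weak_lap n z (x + x') y = (LBINT s. indicator {0..} s *\<^sub>R (of_real (s ^ n) * exp (- (z * of_real s)) * cinner (T s x) y)
    + indicator {0..} s *\<^sub>R (of_real (s ^ n) * exp (- (z * of_real s)) * cinner (T s x') y))"
    unfolding weak_lap_def
    by (rule Bochner_Integration.integral_cong) (auto simp: indicator_def T_plus cinner_simps algebra_simps)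
  then show "weak_lap n z (x + x') y = weak_lap n z x y + weak_lap n z x' y"
    unfolding weak_lap_def by (simp only: Bochner_Integration.integral_add[OF weak_lap_integrable weak_lap_integrable] assms)
  have "weak_lap n z (c *\<^sub>C x) y = (LBINT s. c * (indicator {0..} s *\<^sub>R (of_real (s ^ n) * exp (- (z * of_real s)) * cinner (T s x) y)))"
    unfolding weak_lap_def
    by (rule Bochner_Integration.integral_cong) (auto simp: indicator_def T_scaleC cinner_simps)
  then show "weak_lap n z (c *\<^sub>C x) y = c * weak_lap n z x y"
    unfolding weak_lap_def by (simp only: integral_mult_right_zero)
qed

lemma laplace_add: "Re z > 0 \<Longrightarrow> laplace z (x + x') = laplace z x + laplace z x'"
  and laplace_scaleC: "Re z > 0 \<Longrightarrow> laplace z (c *\<^sub>C x) = c *\<^sub>C laplace z x"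
  by (rule cinner_ext, simp add: cinner_laplace_eq weak_lap_linear cinner_simps)+

lemma laplace_minus: "Re z > 0 \<Longrightarrow> laplace z (- x) = - laplace z x"
  using laplace_scaleC[of z "-1" x] scaleR_scaleC[of "-1"] by (metis of_real_1 of_real_minus scaleR_minus1_left)

lemma laplace_diff: "Re z > 0 \<Longrightarrow> laplace z (x - x') = laplace z x - laplace z x'"
  using laplace_add[of z x "- x'"] by (simp add: laplace_minus)

lemma norm_laplace_le:
  assumes z: "Re z > 0" shows "norm (laplace z x) \<le> K / Re z * norm x"
proof (cases "laplace z x = 0")
  case False
  let ?v = "laplace z x"
  have "(norm ?v)\<^sup>2 = cmod (cinner ?v ?v)" by (simp add: cinner_self del: of_real_power)
  also have "\<dots> \<le> (LBINT s. K * norm x * norm ?v * (indicator {0..} s * (s ^ 0 * exp (- (Re z * s)))))"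
    unfolding cinner_laplace_eq[OF z] weak_lap_def
  proof (rule Bochner_Integration.integral_norm_bound_integral)
    show "integrable lborel (\<lambda>s. K * norm x * norm ?v * (indicator {0..} s * (s ^ 0 * exp (- (Re z * s)))))"
      using has_bochner_integral_power_exp[OF z, of 0] by (intro integrable_mult_right) (auto dest: integrable.intros)
    show "norm (indicator {0..} s *\<^sub>R (of_real (s ^ 0) * exp (- (z * of_real s)) * cinner (T s x) ?v))
        \<le> K * norm x * norm ?v * (indicator {0..} s * (s ^ 0 * exp (- (Re z * s))))" for s :: real
      using norm_weighted_orbit_le[of s 0 z x ?v] by (auto simp: indicator_def)
  qed (rule weak_lap_integrable[OF z])
  also have "\<dots> = K * norm x * norm ?v * (1 / Re z)"
    using has_bochner_integral_integral_eq[OF has_bochner_integral_power_exp[OF z, of 0]] by simp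
  finally have "norm ?v * norm ?v \<le> (K / Re z * norm x) * norm ?v" by (simp add: power2_eq_square mult_ac)
  then show ?thesis by (rule mult_right_le_imp_le) (use False in simp)
qed (use K_ge_1 z in \<open>auto intro!: mult_nonneg_nonneg divide_nonneg_pos\<close>)

text \<open>
  Integration by parts: \<open>exp (- z * s) * T s (z * x + A x)\<close> is minus the derivative of
  \<open>exp (- z * s) * T s x\<close>. A factor \<open>s ^ Suc n\<close> removes the boundary term at \<open>0\<close> and leaves \<open>s ^ n\<close>.
\<close>

lemma weak_lap_generator:
  assumes z: "Re z > 0" and x: "x \<in> D"
  shows "weak_lap 0 z (z *\<^sub>C x + A x) y = cinner x y"
    and "weak_lap (Suc n) z (z *\<^sub>C x + A x) y = of_nat (Suc n) * weak_lap n z x y"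
proof -
  define e where "e = (\<lambda>n s. of_real (s ^ n) * exp (- (z * of_real s)))"
  define c where "c = (\<lambda>s. cinner (T s x) y)"
  have dc: "(c has_vector_derivative - cinner (T s (A x)) y) (at s within {0..})" if "0 \<le> s" for s
    using bounded_linear.has_vector_derivative[OF bounded_linear_cinner_left T_derivative[OF x that]]
    by (simp add: c_def cinner_simps)
  have de: "((\<lambda>s. exp (- (z * of_real s))) has_vector_derivative - z * exp (- (z * of_real s))) (at s within {0..})" for s
    by (rule has_vector_derivative_real_field) (auto intro!: derivative_eq_intros)
  have dp: "((\<lambda>s. complex_of_real (s ^ Suc n)) has_vector_derivative of_nat (Suc n) * of_real (s ^ n)) (at s within {0..})" for n s
    unfolding of_real_power
    by (rule has_vector_derivative_real_field, rule DERIV_cong[OF DERIV_power_Suc[OF DERIV_ident]]) simp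
  have lim: "((\<lambda>s. e n s * c s) \<longlongrightarrow> 0) at_top" for n
  proof (rule Lim_null_comparison)
    show "\<forall>\<^sub>F s in at_top. norm (e n s * c s) \<le> K * norm x * norm y * (s ^ n * exp (- (Re z * s)))"
      unfolding e_def c_def using eventually_ge_at_top[of 0] by eventually_elim (rule norm_weighted_orbit_le)
    show "((\<lambda>s. K * norm x * norm y * (s ^ n * exp (- (Re z * s)))) \<longlongrightarrow> 0) at_top"
      by (intro tendsto_mult_right_zero power_times_exp_tendsto_0 z)
  qed
  have zA: "cinner (T s (z *\<^sub>C x + A x)) y = z * c s + cinner (T s (A x)) y" if "0 \<le> s" for s
    using that by (simp add: T_plus T_scaleC cinner_simps c_def)
  have int: "integrable lborel (\<lambda>s. indicator {0..} s *\<^sub>R (e n s * cinner (T s u) y))" for n u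
    unfolding e_def by (rule weak_lap_integrable[OF z])
  have cont: "continuous_on {0..} (\<lambda>s. e n s * cinner (T s u) y)" for n u
    unfolding e_def by (intro continuous_intros continuous_on_cinner_T)
  have "(LBINT s. indicator {0..} s *\<^sub>R - (e 0 s * cinner (T s (z *\<^sub>C x + A x)) y)) = - (e 0 0 * c 0)"
  proof (rule integral_halfline_derivative[OF _ _ _ lim])
    fix s :: real assume s: "0 \<le> s"
    show "((\<lambda>s. e 0 s * c s) has_vector_derivative - (e 0 s * cinner (T s (z *\<^sub>C x + A x)) y)) (at s within {0..})"
      using has_vector_derivative_mult[OF de dc[OF s]] zA[OF s] by (simp add: e_def algebra_simps)
  next
    show "continuous_on {0..} (\<lambda>s. - (e 0 s * cinner (T s (z *\<^sub>C x + A x)) y))"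
      by (intro continuous_on_minus cont)
    show "integrable lborel (\<lambda>s. indicator {0..} s *\<^sub>R - (e 0 s * cinner (T s (z *\<^sub>C x + A x)) y))"
      using int by simp
  qed
  then show "weak_lap 0 z (z *\<^sub>C x + A x) y = cinner x y"
    by (simp add: weak_lap_def e_def c_def T_0)
  have "(LBINT s. indicator {0..} s *\<^sub>R (of_nat (Suc n) * (e n s * cinner (T s x) y) - (e (Suc n) s * cinner (T s (z *\<^sub>C x + A x)) y))) = - (e (Suc n) 0 * c 0)"
  proof (rule integral_halfline_derivative[OF _ _ _ lim])
    fix s :: real assume s: "0 \<le> s"
    show "((\<lambda>s. e (Suc n) s * c s) has_vector_derivative of_nat (Suc n) * (e n s * cinner (T s x) y) - (e (Suc n) s * cinner (T s (z *\<^sub>C x + A x)) y)) (at s within {0..})"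
      using has_vector_derivative_mult[OF has_vector_derivative_mult[OF dp de] dc[OF s], of n] zA[OF s]
      by (simp add: e_def c_def algebra_simps)
  next
    show "continuous_on {0..} (\<lambda>s. of_nat (Suc n) * (e n s * cinner (T s x) y) - (e (Suc n) s * cinner (T s (z *\<^sub>C x + A x)) y))"
      by (intro continuous_intros cont)
    show "integrable lborel (\<lambda>s. indicator {0..} s *\<^sub>R (of_nat (Suc n) * (e n s * cinner (T s x) y) - (e (Suc n) s * cinner (T s (z *\<^sub>C x + A x)) y)))"
      using Bochner_Integration.integrable_diff[OF integrable_mult_right[OF int[of n x], of "of_nat (Suc n)"] int[of "Suc n" "z *\<^sub>C x + A x"]]
      by (simp add: scaleR_diff_right)
  qed
  moreover have "(LBINT s. indicator {0..} s *\<^sub>R (of_nat (Suc n) * (e n s * cinner (T s x) y) - (e (Suc n) s * cinner (T s (z *\<^sub>C x + A x)) y)))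
     = of_nat (Suc n) * weak_lap n z x y - weak_lap (Suc n) z (z *\<^sub>C x + A x) y"
  proof -
    have "(\<lambda>s. indicator {0..} s *\<^sub>R (of_nat (Suc n) * (e n s * cinner (T s x) y) - (e (Suc n) s * cinner (T s (z *\<^sub>C x + A x)) y)))
      = (\<lambda>s. of_nat (Suc n) * (indicator {0..} s *\<^sub>R (e n s * cinner (T s x) y)) - indicator {0..} s *\<^sub>R (e (Suc n) s * cinner (T s (z *\<^sub>C x + A x)) y))"
      by (auto simp: fun_eq_iff indicator_def)
    then show ?thesis
      using Bochner_Integration.integral_diff[OF integrable_mult_right[OF int[of n x], of "of_nat (Suc n)"] int[of "Suc n" "z *\<^sub>C x + A x"]]
      by (simp only: weak_lap_def e_def integral_mult_right_zero)
  qed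
  moreover have "e (Suc n) 0 = 0" by (simp add: e_def)
  ultimately show "weak_lap (Suc n) z (z *\<^sub>C x + A x) y = of_nat (Suc n) * weak_lap n z x y" by simp
qed

lemma laplace_left_inverse:
  assumes "Re z > 0" "x \<in> D" shows "laplace z (z *\<^sub>C x + A x) = x"
  by (rule cinner_ext) (simp add: cinner_laplace_eq assms weak_lap_generator)

lemma S_laplace_commute:
  assumes z: "Re z > 0" shows "S \<xi> (laplace z x) = laplace z (S \<xi> x)"
proof (rule cinner_ext)
  fix y
  have F: "bounded_linear (\<lambda>u. cinner (S \<xi> u) y)"
    by (rule bounded_linear_compose[OF bounded_linear_cinner_left bounded_linear_S])
  have "cinner (S \<xi> (laplace z x)) y = (LBINT s. cinner (S \<xi> (lap_orbit z x s)) y)"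
    by (rule laplace_functional(2)[OF z F])
  also have "\<dots> = (LBINT s. cinner (lap_orbit z (S \<xi> x) s) y)"
    by (rule Bochner_Integration.integral_cong)
      (auto simp: lap_orbit_def indicator_def S_scaleC S_T_commute linear_0[OF bounded_linear.linear[OF bounded_linear_S]])
  also have "\<dots> = cinner (laplace z (S \<xi> x)) y"
    by (rule laplace_functional(2)[OF z bounded_linear_cinner_left, symmetric])
  finally show "cinner (S \<xi> (laplace z x)) y = cinner (laplace z (S \<xi> x)) y" .
qed

text \<open>
  The resolvent identity between \<open>a + \<i> * \<xi>\<close> and \<open>\<i> * \<xi>\<close>. Since \<open>a\<close> times the Laplace transform is bounded
  by \<open>K\<close>, it bounds the resolvent at \<open>a + \<i> * \<xi>\<close> by the one on the imaginary axis uniformly in \<open>a\<close>, and it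
  shows that the Laplace transform takes its values in the domain, hence is a two-sided inverse.
\<close>

lemma laplace_eq_S:
  assumes a: "a > 0"
  shows "laplace (Complex a \<xi>) u = S \<xi> (u - a *\<^sub>R laplace (Complex a \<xi>) u)"
proof -
  let ?z = "Complex a \<xi>"
  have z: "Re ?z > 0" using a by simp
  have "?z *\<^sub>C S \<xi> u + A (S \<xi> u) = a *\<^sub>R S \<xi> u + u"
    using S_right[of \<xi> u] by (simp add: Complex_eq scaleC_add_left add.assoc scaleR_scaleC)
  then have "a *\<^sub>R laplace ?z (S \<xi> u) + laplace ?z u = S \<xi> u"
    using laplace_left_inverse[OF z S_in_D[of \<xi> u]] z by (simp add: laplace_add scaleR_scaleC laplace_scaleC)
  then have "laplace ?z u = S \<xi> u - a *\<^sub>R S \<xi> (laplace ?z u)"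
    by (simp add: S_laplace_commute[OF z] algebra_simps)
  then show ?thesis
    by (simp add: linear_diff[OF bounded_linear.linear[OF bounded_linear_S]] linear_scale[OF bounded_linear.linear[OF bounded_linear_S]])
qed

lemma laplace_right_inverse:
  assumes a: "a > 0"
  shows "laplace (Complex a \<xi>) u \<in> D"
    and "Complex a \<xi> *\<^sub>C laplace (Complex a \<xi>) u + A (laplace (Complex a \<xi>) u) = u"
proof -
  let ?z = "Complex a \<xi>" and ?w = "u - a *\<^sub>R laplace (Complex a \<xi>) u"
  show "laplace ?z u \<in> D" using laplace_eq_S[OF a, of \<xi> u] S_in_D[of \<xi> ?w] by simp
  have "(\<i> * of_real \<xi>) *\<^sub>C laplace ?z u + A (laplace ?z u) = ?w"
    using S_right[of \<xi> ?w] laplace_eq_S[OF a, of \<xi> u] by simp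
  then show "?z *\<^sub>C laplace ?z u + A (laplace ?z u) = u"
    by (simp add: Complex_eq scaleC_add_left add.assoc scaleR_scaleC)
qed

lemma laplace_resolvent_identity:
  assumes a: "a > 0"
  shows "laplace (Complex a \<xi>) u - laplace (Complex a \<eta>) u
      = (Complex a \<eta> - Complex a \<xi>) *\<^sub>C laplace (Complex a \<xi>) (laplace (Complex a \<eta>) u)"
proof -
  let ?z = "Complex a \<xi>" and ?w = "Complex a \<eta>"
  let ?x = "laplace ?w u"
  have z: "Re ?z > 0" using a by simp
  have "?z *\<^sub>C ?x + A ?x = u + (?z - ?w) *\<^sub>C ?x"
    using laplace_right_inverse(2)[OF a, of \<eta> u] scaleC_add_left[of "?z - ?w" ?w ?x] by (simp add: algebra_simps)
  then have "?x = laplace ?z u + (?z - ?w) *\<^sub>C laplace ?z ?x"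
    using laplace_left_inverse[OF z laplace_right_inverse(1)[OF a, of \<eta> u]] z by (simp add: laplace_add laplace_scaleC)
  moreover have "(?w - ?z) *\<^sub>C laplace ?z ?x = - ((?z - ?w) *\<^sub>C laplace ?z ?x)"
    by (metis bounded_bilinear.minus_left[OF bounded_bilinear_scaleC] minus_diff_eq)
  ultimately show ?thesis by (simp add: algebra_simps)
qed

lemma continuous_on_laplace:
  assumes a: "a > 0" and p: "continuous_on UNIV p"
  shows "continuous_on UNIV (\<lambda>\<xi>. laplace (Complex a \<xi>) (p \<xi>))"
  unfolding continuous_on_def
proof
  fix \<xi> :: real
  let ?L = "\<lambda>\<eta>. laplace (Complex a \<eta>)"
  have est: "norm (?L \<eta> (p \<eta>) - ?L \<xi> (p \<xi>)) \<le> K / a * norm (p \<eta> - p \<xi>) + \<bar>\<xi> - \<eta>\<bar> * (K / a * norm (?L \<xi> (p \<xi>)))" for \<eta>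
  proof -
    have "?L \<eta> (p \<eta>) - ?L \<xi> (p \<xi>) = ?L \<eta> (p \<eta> - p \<xi>) + (?L \<eta> (p \<xi>) - ?L \<xi> (p \<xi>))"
      using a by (simp add: laplace_diff)
    also have "norm \<dots> \<le> norm (?L \<eta> (p \<eta> - p \<xi>)) + norm (?L \<eta> (p \<xi>) - ?L \<xi> (p \<xi>))"
      by (rule norm_triangle_ineq)
    also have "norm (?L \<eta> (p \<xi>) - ?L \<xi> (p \<xi>)) = \<bar>\<xi> - \<eta>\<bar> * norm (?L \<eta> (?L \<xi> (p \<xi>)))"
      unfolding laplace_resolvent_identity[OF a] norm_scaleC by (simp add: cmod_def)
    also have "norm (?L \<eta> (?L \<xi> (p \<xi>))) \<le> K / a * norm (?L \<xi> (p \<xi>))"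
      using norm_laplace_le[of "Complex a \<eta>"] a by simp
    also have "norm (?L \<eta> (p \<eta> - p \<xi>)) \<le> K / a * norm (p \<eta> - p \<xi>)"
      using norm_laplace_le[of "Complex a \<eta>"] a by simp
    finally show ?thesis by (simp add: mult_left_mono)
  qed
  have pl: "(p \<longlongrightarrow> p \<xi>) (at \<xi> within UNIV)" using p by (auto simp: continuous_on_def)
  have "((\<lambda>\<eta>. K / a * norm (p \<eta> - p \<xi>) + \<bar>\<xi> - \<eta>\<bar> * (K / a * norm (?L \<xi> (p \<xi>)))) \<longlongrightarrow> K / a * norm (p \<xi> - p \<xi>) + \<bar>\<xi> - \<xi>\<bar> * (K / a * norm (?L \<xi> (p \<xi>)))) (at \<xi> within UNIV)"
    by (intro tendsto_intros pl)
  then have lim0: "((\<lambda>\<eta>. K / a * norm (p \<eta> - p \<xi>) + \<bar>\<xi> - \<eta>\<bar> * (K / a * norm (?L \<xi> (p \<xi>)))) \<longlongrightarrow> 0) (at \<xi> within UNIV)"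
    by simp
  have "((\<lambda>\<eta>. ?L \<eta> (p \<eta>) - ?L \<xi> (p \<xi>)) \<longlongrightarrow> 0) (at \<xi> within UNIV)"
    by (rule Lim_null_comparison[OF always_eventually lim0]) (use est in blast)
  then show "((\<lambda>\<eta>. ?L \<eta> (p \<eta>)) \<longlongrightarrow> ?L \<xi> (p \<xi>)) (at \<xi> within UNIV)" by (rule LIM_zero_cancel)
qed

lemma norm_laplace_le_S:
  assumes a: "a > 0" and N: "\<And>u. norm (S \<xi> u) \<le> N * norm u" "N \<ge> 0"
  shows "norm (laplace (Complex a \<xi>) u) \<le> (1 + K) * N * norm u"
proof -
  let ?L = "laplace (Complex a \<xi>) u"
  have 1: "norm ?L \<le> N * norm (u - a *\<^sub>R ?L)" by (subst laplace_eq_S[OF a]) (rule N)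
  have 2: "norm (u - a *\<^sub>R ?L) \<le> norm u + K * norm u"
  proof -
    have "norm (u - a *\<^sub>R ?L) \<le> norm u + a * norm ?L"
    using norm_triangle_ineq4[of u "a *\<^sub>R ?L"] a by simp
    also have "a * norm ?L \<le> K * norm u"
      using norm_laplace_le[of "Complex a \<xi>" u] a by (simp add: field_simps)
    finally show ?thesis by simp
  qed
  from order_trans[OF 1 mult_left_mono[OF 2 N(2)]] show ?thesis by (simp add: algebra_simps)
qed

lemma weak_lap_eq_power:
  assumes a: "a > 0"
  shows "weak_lap n (Complex a \<xi>) u y = fact n * cinner ((laplace (Complex a \<xi>) ^^ Suc n) u) y"
proof (induction n arbitrary: u)
  case 0
  then show ?case using a by (simp add: cinner_laplace_eq)
next
  case (Suc n)
  let ?z = "Complex a \<xi>"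
  have "weak_lap (Suc n) ?z u y = of_nat (Suc n) * weak_lap n ?z (laplace ?z u) y"
    using weak_lap_generator(2)[OF _ laplace_right_inverse(1)[OF a], of ?z n \<xi> u y] laplace_right_inverse(2)[OF a, of \<xi> u] a by simp
  also have "\<dots> = fact (Suc n) * cinner ((laplace ?z ^^ Suc n) (laplace ?z u)) y"
    by (simp only: Suc.IH fact_Suc of_nat_mult mult.assoc)
  also have "(laplace ?z ^^ Suc n) (laplace ?z u) = (laplace ?z ^^ Suc (Suc n)) u"
    by (simp only: funpow_Suc_right o_def)
  finally show ?case .
qed

text \<open>
  On the line with real part \<open>a\<close>, the resolvent applied to \<open>x\<close> is the Fourier transform of the orbit
  damped by \<open>exp (- a * s)\<close>, whose square integral is at most \<open>(K * norm x)\<^sup>2 / (2 * a)\<close>.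
\<close>

lemma Plancherel_laplace:
  assumes a: "a > 0"
  shows "integrable lborel (\<lambda>\<xi>. (norm (laplace (Complex a \<xi>) x))\<^sup>2)"
    and "(LBINT \<xi>. (norm (laplace (Complex a \<xi>) x))\<^sup>2) \<le> pi * (K * norm x)\<^sup>2 / a"
proof -
  define q where "q = lap_orbit (of_real a) x"
  define g where "g = (\<lambda>s. indicator {0..} s * (K * norm x * exp (- (a * s))))"
  define f where "f = (\<lambda>s. exp (- (of_real a * of_real \<bar>s\<bar>)) *\<^sub>C T \<bar>s\<bar> x)"
  have f_cont: "continuous_on UNIV f"
    unfolding f_def
    by (intro continuous_on_compose2[OF continuous_on_weighted_orbit, of UNIV "\<lambda>s. \<bar>s\<bar>"] continuous_intros) auto
  have "(\<lambda>(s, r). cinner (f s) (f r)) \<in> borel_measurable (borel \<Otimes>\<^sub>M borel)"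
    unfolding borel_prod split_beta'
    by (intro borel_measurable_continuous_onI bounded_bilinear.continuous_on[OF bounded_bilinear_cinner]
        continuous_on_compose2[OF f_cont] continuous_intros) auto
  then have "(\<lambda>(s, r). (indicator {0..} s * indicator {0..} r) *\<^sub>R cinner (f s) (f r)) \<in> borel_measurable (borel \<Otimes>\<^sub>M borel)"
    by (simp add: split_beta')
  moreover have "(\<lambda>(s, r). (indicator {0..} s * indicator {0..} r) *\<^sub>R cinner (f s) (f r)) = (\<lambda>(s, r). cinner (q s) (q r))"
    by (auto simp: q_def lap_orbit_def f_def indicator_def cinner_simps fun_eq_iff)
  ultimately have meas: "(\<lambda>(s, r). cinner (q s) (q r)) \<in> borel_measurable (lborel \<Otimes>\<^sub>M lborel)"
    by (simp cong: measurable_cong_sets)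
  have bd: "norm (q s) \<le> g s" for s using norm_lap_orbit_le[of "of_real a" x s] by (simp add: q_def g_def)
  have gi: "integrable lborel g" unfolding g_def by (rule integrable_orbit_bound[OF a])
  have gb: "g \<in> borel_measurable borel" using gi by (simp add: borel_measurable_integrable)
  have a2: "2 * a > 0" using a by simp
  have g2: "(\<lambda>s. (g s)\<^sup>2) = (\<lambda>s. (K * norm x)\<^sup>2 * (indicator {0..} s * (s ^ 0 * exp (- (2 * a * s)))))"
    by (auto simp: g_def fun_eq_iff indicator_def power_mult_distrib simp flip: exp_double)
  have hb: "has_bochner_integral lborel (\<lambda>s. (g s)\<^sup>2) ((K * norm x)\<^sup>2 * (1 / (2 * a)))"
    unfolding g2 using has_bochner_integral_mult_right[OF has_bochner_integral_power_exp[OF a2, of 0]] by simp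
  have v: "cinner (laplace (Complex a \<xi>) x) y = (LBINT s. exp (- (\<i> * of_real (\<xi> * s))) * cinner (q s) y)" for \<xi> y
  proof -
    have "cinner (laplace (Complex a \<xi>) x) y = (LBINT s. indicator {0..} s *\<^sub>R (exp (- (Complex a \<xi> * of_real s)) * cinner (T s x) y))"
      using a by (intro cinner_laplace) simp
    also have "\<dots> = (LBINT s. exp (- (\<i> * of_real (\<xi> * s))) * cinner (q s) y)"
      by (rule Bochner_Integration.integral_cong)
        (auto simp: q_def lap_orbit_def indicator_def cinner_simps Complex_eq algebra_simps mult_exp_exp[symmetric] simp flip: exp_add)
    finally show ?thesis .
  qed
  note * = Plancherel_inequality[OF meas bd gi bd gb integrable.intros[OF hb] v]
  show "integrable lborel (\<lambda>\<xi>. (norm (laplace (Complex a \<xi>) x))\<^sup>2)" by (rule *(1))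
  show "(LBINT \<xi>. (norm (laplace (Complex a \<xi>) x))\<^sup>2) \<le> pi * (K * norm x)\<^sup>2 / a"
    using *(2) has_bochner_integral_integral_eq[OF hb] by simp
qed

end

section \<open>Decay of orbits from growth of the resolvent\<close>

text \<open>
  A single term of the exponential series is at most \<open>exp (s / t)\<close>.
\<close>

lemma power_exp_decay_le:
  assumes "t > 0" "s \<ge> (0::real)"
  shows "s ^ k * exp (- (1 / t * s)) \<le> fact k * t ^ k"
proof -
  let ?x = "s / t"
  have x: "?x \<ge> 0" using assms by simp
  have "(\<Sum>i\<in>{k}. ?x ^ i /\<^sub>R fact i) \<le> (\<Sum>i. ?x ^ i /\<^sub>R fact i)"
    by (rule sum_le_suminf) (use summable_exp_generic[of ?x] x in auto)
  then have "?x ^ k / fact k \<le> exp ?x" by (simp add: exp_def divide_inverse mult.commute)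
  then show ?thesis using assms by (simp add: exp_minus power_divide field_simps)
qed

context imaginary_resolvent_semigroup
begin

lemma norm_laplace_power_le:
  assumes "\<And>u. norm (laplace z u) \<le> c * norm u" "c \<ge> 0"
  shows "norm ((laplace z ^^ k) u) \<le> c ^ k * norm u"
proof (induction k)
  case (Suc k)
  have "norm ((laplace z ^^ Suc k) u) \<le> c * norm ((laplace z ^^ k) u)" using assms(1) by simp
  also have "\<dots> \<le> c * (c ^ k * norm u)" using Suc assms(2) by (rule mult_left_mono)
  finally show ?case by (simp add: mult.assoc)
qed simp

lemma continuous_on_laplace_power:
  assumes a: "a > 0"
  shows "continuous_on UNIV (\<lambda>\<xi>. (laplace (Complex a \<xi>) ^^ k) u)"
proof (induction k)
  case (Suc k)
  show ?case using continuous_on_laplace[OF a Suc] by simp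
qed simp

text \<open>
  The factor \<open>1 + \<bar>\<xi>\<bar>\<close> is gained because \<open>z\<close> times the resolvent at \<open>z\<close> applied to \<open>S 0 u\<close> equals \<open>S 0 u\<close>
  minus the resolvent applied to \<open>u\<close>.
\<close>

lemma norm_laplace_S0_le:
  assumes a: "a > 0" and N: "\<And>u. norm (S \<xi> u) \<le> N * norm u" "N \<ge> 1"
    and B: "\<And>u. norm (S 0 u) \<le> B * norm u" "B \<ge> 0"
  shows "norm (laplace (Complex a \<xi>) (S 0 u)) * (1 + \<bar>\<xi>\<bar>) \<le> (B + (1 + K) * (1 + B)) * N * norm u"
proof -
  let ?z = "Complex a \<xi>"
  have z: "Re ?z > 0" using a by simp
  have L: "norm (laplace ?z v) \<le> (1 + K) * N * norm v" for v
    by (rule norm_laplace_le_S[OF a N(1)]) (use N(2) in simp)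
  have "?z *\<^sub>C laplace ?z (S 0 u) = S 0 u - laplace ?z u"
    using laplace_left_inverse[OF z S_in_D[of 0 u]] z by (simp add: A_S0 laplace_add laplace_scaleC algebra_simps)
  then have "cmod ?z * norm (laplace ?z (S 0 u)) = norm (S 0 u - laplace ?z u)" by (metis norm_scaleC)
  also have "\<dots> \<le> B * norm u + (1 + K) * N * norm u"
    using norm_triangle_ineq4[of "S 0 u" "laplace ?z u"] B(1)[of u] L[of u] by linarith
  also have "B * norm u \<le> B * N * norm u"
    using mult_left_mono[OF N(2), of "B * norm u"] B(2) by (simp add: mult_ac)
  finally have 1: "cmod ?z * norm (laplace ?z (S 0 u)) \<le> B * N * norm u + (1 + K) * N * norm u" by simp
  have "\<bar>\<xi>\<bar> * norm (laplace ?z (S 0 u)) \<le> cmod ?z * norm (laplace ?z (S 0 u))"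
    using abs_Im_le_cmod[of ?z] by (intro mult_right_mono) auto
  note 2 = order_trans[OF this 1]
  have "norm (laplace ?z (S 0 u)) \<le> (1 + K) * N * norm (S 0 u)" by (rule L)
  also have "\<dots> \<le> (1 + K) * N * (B * norm u)" using B(1) K_ge_1 N(2) by (intro mult_left_mono) auto
  finally show ?thesis using 2 by (simp add: algebra_simps)
qed

text \<open>
  Of the \<open>j + 2\<close> resolvents one is kept as a vector, for Plancherel; one absorbs \<open>S 0\<close>, which gains the
  denominator; the others are estimated in norm.
\<close>

lemma norm_laplace_power_S0_le:
  assumes a: "a > 0" and N: "\<And>u. norm (S \<xi> u) \<le> N * norm u" "N \<ge> 1"
    and B: "\<And>u. norm (S 0 u) \<le> B * norm u" "B \<ge> 0"
  shows "norm ((laplace (Complex a \<xi>) ^^ Suc (Suc j)) (S 0 x))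
     \<le> (1 + K) ^ j * (B + (1 + K) * (1 + B)) * (N ^ Suc j / (1 + \<bar>\<xi>\<bar>)) * norm (laplace (Complex a \<xi>) x)"
proof -
  let ?L = "laplace (Complex a \<xi>)"
  have z: "Re (Complex a \<xi>) > 0" using a by simp
  have L: "norm (?L v) \<le> (1 + K) * N * norm v" for v
    by (rule norm_laplace_le_S[OF a N(1)]) (use N(2) in simp)
  have KN: "(1 + K) * N \<ge> 0" using K_ge_1 N(2) by simp
  have "(?L ^^ Suc (Suc j)) (S 0 x) = (?L ^^ j) (?L (S 0 (?L x)))"
    by (simp only: funpow_Suc_right o_def S_laplace_commute[OF z])
  also have "norm \<dots> \<le> ((1 + K) * N) ^ j * norm (?L (S 0 (?L x)))"
    by (rule norm_laplace_power_le[OF L KN])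
  also have "\<dots> \<le> ((1 + K) * N) ^ j * ((B + (1 + K) * (1 + B)) * N * norm (?L x) / (1 + \<bar>\<xi>\<bar>))"
  proof (rule mult_left_mono)
    show "norm (?L (S 0 (?L x))) \<le> (B + (1 + K) * (1 + B)) * N * norm (?L x) / (1 + \<bar>\<xi>\<bar>)"
      using norm_laplace_S0_le[OF a N B, of "?L x"] by (simp add: pos_le_divide_eq)
  qed (use KN in simp)
  finally show ?thesis by (simp add: power_mult_distrib mult_ac)
qed

text \<open>
  Writing the resolvent as an integral of \<open>exp (- a * s) * T s\<close> over \<open>s\<close> and exchanging the order of
  integration gives the integral of \<open>exp (- a * s) * T s (v s)\<close>, where \<open>v\<close> is the Fourier transform of
  the weighted function \<open>p\<close>. As \<open>T\<close> is bounded, only the square integral of \<open>v\<close> matters, and this is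
  controlled by Plancherel.
\<close>

lemma norm_oscillatory_laplace_le:
  fixes p :: "real \<Rightarrow> 'a"
  assumes t: "t > 0" and \<sigma>: "\<sigma> > 0"
    and p: "continuous_on UNIV p" "\<And>\<xi>. norm (p \<xi>) \<le> P"
    and g: "\<And>\<xi>. exp (- (\<sigma>\<^sup>2 * \<xi>\<^sup>2 / 2)) * norm (p \<xi>) \<le> g \<xi>" "g \<in> borel_measurable borel"
      "integrable lborel (\<lambda>\<xi>. (g \<xi>)\<^sup>2)" "(LBINT \<xi>. (g \<xi>)\<^sup>2) \<le> G\<^sup>2 * t" and G: "G > 0"
  shows "cmod (LBINT \<xi>. of_real (exp (- (\<sigma>\<^sup>2 * \<xi>\<^sup>2 / 2))) * exp (\<i> * of_real (\<xi> * t))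
           * cinner (laplace (Complex (1 / t) \<xi>) (p \<xi>)) y) \<le> sqrt (2 * pi) * K * G * t * norm y"
proof -
  define a where "a = 1 / t"
  have a: "a > 0" using t by (simp add: a_def)
  define w where "w = (\<lambda>\<xi>. exp (- (\<sigma>\<^sup>2 * \<xi>\<^sup>2 / 2)))"
  have w0: "w \<xi> > 0" for \<xi> by (simp add: w_def)
  have w_cont: "continuous_on X (\<lambda>x. w (f x))" if "continuous_on X f" for X :: "'b::topological_space set" and f
    unfolding w_def by (intro continuous_intros that) auto
  have wi: "integrable lborel w" unfolding w_def by (rule Fourier_gaussian(1)[OF \<sigma>])
  define q where "q = (\<lambda>\<xi>. (of_real (w \<xi>) * exp (\<i> * of_real (\<xi> * t))) *\<^sub>C p \<xi>)"
  define f where "f = (\<lambda>s \<xi>. exp (- (\<i> * of_real (s * \<xi>))) *\<^sub>C q \<xi>)"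
  define v where "v = (\<lambda>s. integral UNIV (f s))"
  have norm_q: "norm (q \<xi>) = w \<xi> * norm (p \<xi>)" for \<xi>
    using w0[of \<xi>] by (simp add: q_def norm_scaleC norm_mult)
  have q_cont: "continuous_on UNIV q"
    unfolding q_def by (intro bounded_bilinear.continuous_on[OF bounded_bilinear_scaleC] continuous_intros w_cont p)
  have f_cont: "continuous_on UNIV (f s)" for s
    unfolding f_def by (intro bounded_bilinear.continuous_on[OF bounded_bilinear_scaleC] continuous_intros q_cont)
  have q_le: "norm (q \<xi>) \<le> P * w \<xi>" for \<xi>
    using mult_left_mono[OF p(2)[of \<xi>], of "w \<xi>"] w0[of \<xi>] by (simp add: norm_q mult.commute)
  have f_le: "norm (f s \<xi>) \<le> P * w \<xi>" for s \<xi>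
    using q_le[of \<xi>] by (simp add: f_def norm_scaleC)
  have Pwi: "integrable lborel (\<lambda>\<xi>. P * w \<xi>)" using wi by simp
  have weak_v: "integrable lborel (\<lambda>\<xi>. F (f s \<xi>))" "F (v s) = (LBINT \<xi>. F (f s \<xi>))"
    if F: "bounded_linear F" for F :: "'a \<Rightarrow> complex" and s
  proof -
    have m: "(\<lambda>\<xi>. F (f s \<xi>)) \<in> borel_measurable borel"
      by (intro borel_measurable_continuous_onI bounded_linear.continuous_on[OF F] f_cont)
    have i: "f s integrable_on {c..d}" for c d
      by (intro integrable_continuous_interval continuous_on_subset[OF f_cont]) simp
    show "integrable lborel (\<lambda>\<xi>. F (f s \<xi>))" "F (v s) = (LBINT \<xi>. F (f s \<xi>))"
      using weak_integral_dominated[OF i f_le Pwi F m] by (simp_all add: v_def)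
  qed
  have cv: "cinner (v s) y' = (LBINT \<xi>. exp (- (\<i> * of_real (s * \<xi>))) * cinner (q \<xi>) y')" for s y'
    using weak_v(2)[OF bounded_linear_cinner_left, of s y'] by (simp add: f_def cinner_simps)
  have q_meas: "(\<lambda>(x, y). cinner (q x) (q y)) \<in> borel_measurable (lborel \<Otimes>\<^sub>M lborel)"
  proof -
    have "(\<lambda>(x, y). cinner (q x) (q y)) \<in> borel_measurable (borel \<Otimes>\<^sub>M borel)"
      unfolding borel_prod split_beta'
      by (intro borel_measurable_continuous_onI bounded_bilinear.continuous_on[OF bounded_bilinear_cinner]
          continuous_on_compose2[OF q_cont] continuous_intros) auto
    then show ?thesis by (simp cong: measurable_cong_sets)
  qed
  have qg: "norm (q \<xi>) \<le> g \<xi>" for \<xi> using g(1) by (simp add: norm_q w_def)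
  note Pl = Plancherel_inequality[OF q_meas q_le Pwi qg g(2,3) cv]
  define V where "V = (LBINT s. (norm (v s))\<^sup>2)"
  have V: "V \<le> (sqrt (2 * pi) * G)\<^sup>2 * t"
  proof -
    have "V \<le> 2 * pi * (LBINT \<xi>. (g \<xi>)\<^sup>2)" unfolding V_def by (rule Pl(2))
    also have "\<dots> \<le> 2 * pi * (G\<^sup>2 * t)" by (intro mult_left_mono g(4)) simp
    finally show ?thesis by (simp add: power_mult_distrib)
  qed
  define H where "H = (\<lambda>\<xi> s. indicator {0..} s *\<^sub>R (of_real (w \<xi>) * exp (\<i> * of_real (\<xi> * t))
      * (exp (- (Complex a \<xi> * of_real s)) * cinner (T s (p \<xi>)) y)))"
  have H_meas: "(\<lambda>(\<xi>, s). H \<xi> s) \<in> borel_measurable (lborel \<Otimes>\<^sub>M lborel)"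
  proof -
    define H' where "H' = (\<lambda>x. of_real (w (fst x)) * exp (\<i> * of_real (fst x * t))
      * (exp (- ((of_real a + \<i> * of_real (fst x)) * of_real (snd x))) * cinner (T \<bar>snd x\<bar> (p (fst x))) y))"
    have Tp: "continuous_on UNIV (\<lambda>x. T \<bar>snd x\<bar> (p (fst x)))"
    proof -
      have "continuous_on UNIV (\<lambda>x. (snd x, fst x) :: real \<times> real)" by (intro continuous_intros)
      from continuous_on_compose2[OF continuous_T_jointly[OF p(1)] this] show ?thesis by simp
    qed
    have "H' \<in> borel_measurable (borel \<Otimes>\<^sub>M borel)"
      unfolding borel_prod H'_def
      by (intro borel_measurable_continuous_onI continuous_intros w_cont
          bounded_linear.continuous_on[OF bounded_linear_cinner_left] Tp)
    then have "(\<lambda>(\<xi>, s). indicator {0..} s *\<^sub>R H' (\<xi>, s)) \<in> borel_measurable (borel \<Otimes>\<^sub>M borel)"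
      by (simp add: split_beta')
    moreover have "(\<lambda>(\<xi>, s). indicator {0..} s *\<^sub>R H' (\<xi>, s)) = (\<lambda>(\<xi>, s). H \<xi> s)"
      by (auto simp: H_def H'_def indicator_def fun_eq_iff Complex_eq)
    ultimately show ?thesis by (simp cong: measurable_cong_sets)
  qed
  have H_int: "integrable (lborel \<Otimes>\<^sub>M lborel) (\<lambda>(\<xi>, s). H \<xi> s)"
  proof (rule Bochner_Integration.integrable_bound)
    show "integrable (lborel \<Otimes>\<^sub>M lborel) (\<lambda>(\<xi>, s). (P * w \<xi>) * (indicator {0..} s * (K * norm y * exp (- (a * s)))))"
      by (rule integrable_tensor[OF Pwi integrable_orbit_bound[OF a]])
    show "(\<lambda>(\<xi>, s). H \<xi> s) \<in> borel_measurable (lborel \<Otimes>\<^sub>M lborel)" by (rule H_meas)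
    show "AE x in lborel \<Otimes>\<^sub>M lborel. norm (case x of (\<xi>, s) \<Rightarrow> H \<xi> s)
        \<le> norm (case x of (\<xi>, s) \<Rightarrow> (P * w \<xi>) * (indicator {0..} s * (K * norm y * exp (- (a * s)))))"
    proof (rule AE_I2, clarify)
      fix \<xi> s :: real
      have "norm (H \<xi> s) \<le> (P * w \<xi>) * (indicator {0..} s * (K * norm y * exp (- (a * s))))"
      proof (cases "0 \<le> s")
        case True
        have "cmod (cinner (T s (p \<xi>)) y) \<le> norm (T s (p \<xi>)) * norm y" by (rule norm_cinner_le)
        also have "\<dots> \<le> (K * P) * norm y"
          using order_trans[OF norm_T_le[OF True, of "p \<xi>"] mult_left_mono[OF p(2)[of \<xi>], of K]] K_ge_1
          by (intro mult_right_mono) auto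
        finally have "w \<xi> * exp (- (a * s)) * cmod (cinner (T s (p \<xi>)) y) \<le> w \<xi> * exp (- (a * s)) * ((K * P) * norm y)"
          using w0[of \<xi>] by (intro mult_left_mono) auto
        then show ?thesis using True w0[of \<xi>] by (simp add: H_def norm_mult mult_ac)
      qed (simp add: H_def)
      then show "norm (H \<xi> s) \<le> norm ((P * w \<xi>) * (indicator {0..} s * (K * norm y * exp (- (a * s)))))"
        by (metis abs_ge_self order_trans real_norm_def)
    qed
  qed
  have inner_s: "(LBINT s. H \<xi> s) = of_real (w \<xi>) * exp (\<i> * of_real (\<xi> * t)) * cinner (laplace (Complex a \<xi>) (p \<xi>)) y" for \<xi>
  proof -
    have "(LBINT s. H \<xi> s) = (LBINT s. of_real (w \<xi>) * exp (\<i> * of_real (\<xi> * t))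
       * (indicator {0..} s *\<^sub>R (exp (- (Complex a \<xi> * of_real s)) * cinner (T s (p \<xi>)) y)))"
      by (simp add: H_def)
    also have "\<dots> = of_real (w \<xi>) * exp (\<i> * of_real (\<xi> * t)) * cinner (laplace (Complex a \<xi>) (p \<xi>)) y"
      using a by (simp only: integral_mult_right_zero cinner_laplace(2) complex.sel)
    finally show ?thesis .
  qed
  have inner_\<xi>: "(LBINT \<xi>. H \<xi> s) = indicator {0..} s *\<^sub>R (of_real (exp (- (a * s))) * cinner (T s (v s)) y)" for s
  proof (cases "0 \<le> s")
    case True
    have F: "bounded_linear (\<lambda>u. cinner (T s u) y)"
      by (rule bounded_linear_compose[OF bounded_linear_cinner_left bounded_linear_T[OF True]])
    have "(LBINT \<xi>. H \<xi> s) = (LBINT \<xi>. of_real (exp (- (a * s))) * cinner (T s (f s \<xi>)) y)"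
    proof (rule Bochner_Integration.integral_cong[OF refl])
      fix \<xi>
      have "exp (- (Complex a \<xi> * of_real s)) = of_real (exp (- (a * s))) * exp (- (\<i> * of_real (s * \<xi>)))"
        by (simp add: Complex_eq algebra_simps flip: exp_add exp_of_real)
      then show "H \<xi> s = of_real (exp (- (a * s))) * cinner (T s (f s \<xi>)) y"
        using True by (simp add: H_def f_def q_def T_scaleC cinner_simps mult_ac)
    qed
    then show ?thesis using True weak_v(2)[OF F, of s] by (simp only: integral_mult_right_zero) simp
  qed (simp add: H_def)
  have J: "(LBINT \<xi>. of_real (w \<xi>) * exp (\<i> * of_real (\<xi> * t)) * cinner (laplace (Complex a \<xi>) (p \<xi>)) y)
      = (LBINT s. indicator {0..} s *\<^sub>R (of_real (exp (- (a * s))) * cinner (T s (v s)) y))"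
    using lborel_pair.Fubini_integral[OF H_int] by (simp add: inner_s inner_\<xi>)
  define c where "c = sqrt (2 * pi) * G"
  have c: "c > 0" using G by (simp add: c_def)
  have a2: "2 * a > 0" using a by simp
  \<comment> \<open>The Cauchy--Schwarz inequality in the form \<open>2 * e * v \<le> c * e\<^sup>2 + v\<^sup>2 / c\<close>, with the optimal order of \<open>c\<close>.\<close>
  define b where "b = (\<lambda>s. K * norm y / 2 * (c * (indicator {0..} s * (s ^ 0 * exp (- (2 * a * s)))) + (norm (v s))\<^sup>2 / c))"
  note hb0 = has_bochner_integral_power_exp[OF a2, of 0]
  have hv: "has_bochner_integral lborel (\<lambda>s. (norm (v s))\<^sup>2) V" unfolding V_def by (rule has_bochner_integral_integrable[OF Pl(1)])
  have hb: "has_bochner_integral lborel b (K * norm y / 2 * (c * (fact 0 / (2 * a) ^ (0 + 1)) + V / c))"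
    unfolding b_def by (intro has_bochner_integral_mult_right has_bochner_integral_add has_bochner_integral_divide_zero hb0 hv)
  have "cmod (LBINT s. indicator {0..} s *\<^sub>R (of_real (exp (- (a * s))) * cinner (T s (v s)) y)) \<le> (LBINT s. b s)"
  proof (rule Bochner_Integration.integral_norm_bound_integral)
    show "integrable lborel (\<lambda>s. indicator {0..} s *\<^sub>R (of_real (exp (- (a * s))) * cinner (T s (v s)) y))"
      using lborel_pair.integrable_snd[OF H_int] by (simp add: inner_\<xi>)
    show "integrable lborel b" by (rule integrable.intros[OF hb])
    fix s :: real
    have b0: "0 \<le> b s" using K_ge_1 c by (simp add: b_def)
    show "norm (indicator {0..} s *\<^sub>R (of_real (exp (- (a * s))) * cinner (T s (v s)) y)) \<le> b s"
    proof (cases "0 \<le> s")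
      case True
      have "norm (indicator {0..} s *\<^sub>R (of_real (exp (- (a * s))) * cinner (T s (v s)) y)) \<le> exp (- (a * s)) * (K * norm (v s) * norm y)"
        using True order_trans[OF norm_cinner_le mult_right_mono[OF norm_T_le[OF True]]] by (simp add: norm_mult mult.assoc)
      also have "\<dots> = K * norm y * (exp (- (a * s)) * norm (v s))" by simp
      also have "\<dots> \<le> K * norm y * ((c * exp (- (2 * a * s)) + (norm (v s))\<^sup>2 / c) / 2)"
      proof (rule mult_left_mono)
        have "0 \<le> (c * exp (- (a * s)) - norm (v s))\<^sup>2 / c" using c by simp
        also have "\<dots> = c * exp (- (2 * a * s)) + (norm (v s))\<^sup>2 / c - 2 * (exp (- (a * s)) * norm (v s))"
        proof -
          have "exp (- (2 * a * s)) = (exp (- (a * s)))\<^sup>2" by (simp add: power2_eq_square flip: exp_add)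
          then show ?thesis using c by (simp add: power2_eq_square field_simps)
        qed
        finally show "exp (- (a * s)) * norm (v s) \<le> (c * exp (- (2 * a * s)) + (norm (v s))\<^sup>2 / c) / 2" by simp
      qed (use K_ge_1 in simp)
      finally show ?thesis using True by (simp add: b_def)
    qed (use b0 in simp)
  qed
  also have "(LBINT s. b s) = K * norm y / 2 * (c * (t / 2) + V / c)"
    using has_bochner_integral_integral_eq[OF hb] by (simp add: a_def)
  also have "\<dots> \<le> K * norm y / 2 * (c * t + c * t)"
  proof (rule mult_left_mono)
    have "V / c \<le> c * t" using V[folded c_def] c by (simp add: pos_divide_le_eq power2_eq_square mult_ac)
    moreover have "c * (t / 2) \<le> c * t" using c t by simp
    ultimately show "c * (t / 2) + V / c \<le> c * t + c * t" by linarith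
  qed (use K_ge_1 in simp)
  finally show ?thesis unfolding J[symmetric] by (simp add: c_def w_def a_def mult_ac)
qed

end

text \<open>
  The mean distance from the centre of a Gaussian is \<open>\<sigma> * sqrt (2 / pi)\<close>.
\<close>

lemma gaussian_average_le:
  fixes \<phi> :: "real \<Rightarrow> complex"
  assumes \<sigma>: "\<sigma> > 0" and lip: "\<And>s. cmod (\<phi> t - \<phi> s) \<le> L * \<bar>s - t\<bar>"
    and i: "integrable lborel (\<lambda>s. of_real (normal_density t \<sigma> s) * \<phi> s)" and L: "L \<ge> 0"
  shows "cmod (\<phi> t) \<le> L * \<sigma> + cmod (LBINT s. of_real (normal_density t \<sigma> s) * \<phi> s)"
proof -
  let ?n = "normal_density t \<sigma>"
  have ni: "integrable lborel (\<lambda>s. of_real (?n s) * \<phi> t)"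
    using integrable_normal_density[OF \<sigma>, of t] by simp
  have "\<phi> t = (LBINT s. of_real (?n s) * \<phi> t)"
    using integral_normal_density[OF \<sigma>, of t] by (simp add: integral_complex_of_real)
  then have "\<phi> t - (LBINT s. of_real (?n s) * \<phi> s) = (LBINT s. of_real (?n s) * \<phi> t - of_real (?n s) * \<phi> s)"
    by (simp only: Bochner_Integration.integral_diff[OF ni i])
  also have "cmod \<dots> \<le> (LBINT s. L * (?n s * \<bar>s - t\<bar> ^ (2 * 0 + 1)))"
  proof (rule Bochner_Integration.integral_norm_bound_integral)
    show "integrable lborel (\<lambda>s. of_real (?n s) * \<phi> t - of_real (?n s) * \<phi> s)"
      by (rule Bochner_Integration.integrable_diff[OF ni i])
    show "integrable lborel (\<lambda>s. L * (?n s * \<bar>s - t\<bar> ^ (2 * 0 + 1)))"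
      by (intro integrable_mult_right integrable_normal_moment_abs \<sigma>)
    fix s
    have "cmod (of_real (?n s) * \<phi> t - of_real (?n s) * \<phi> s) = ?n s * cmod (\<phi> t - \<phi> s)"
      by (simp add: norm_mult flip: right_diff_distrib)
    also have "\<dots> \<le> ?n s * (L * \<bar>s - t\<bar>)" by (intro mult_left_mono lip) simp
    finally show "cmod (of_real (?n s) * \<phi> t - of_real (?n s) * \<phi> s) \<le> L * (?n s * \<bar>s - t\<bar> ^ (2 * 0 + 1))"
      by (simp add: mult_ac)
  qed
  also have "\<dots> = L * (\<sigma> * sqrt (2 / pi))"
    using integral_normal_moment_abs_odd[OF \<sigma>, of t 0] by (simp only: integral_mult_right_zero) simp
  also have "\<dots> \<le> L * (\<sigma> * 1)"
    using L \<sigma> pi_ge_two by (intro mult_left_mono) auto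
  finally show ?thesis using norm_triangle_sub[of "\<phi> t" "LBINT s. of_real (?n s) * \<phi> s"] by simp
qed

context imaginary_resolvent_semigroup
begin

text \<open>
  The derivative has three terms; each is bounded because \<open>s ^ k * exp (- s / t)\<close> is at most
  \<open>fact k * t ^ k\<close> and because the derivative of the orbit of \<open>S 0 x\<close> is the bounded orbit of \<open>- x\<close>.
\<close>

lemma weighted_orbit_Lipschitz:
  fixes m :: nat and x y :: 'a
  assumes t: "t \<ge> 1" and B: "\<And>u. norm (S 0 u) \<le> B * norm u" "B \<ge> 0" and s: "0 \<le> s" "0 \<le> r"
  defines "e \<equiv> \<lambda>s. of_real (s ^ Suc m) * exp (- (of_real (1 / t) * of_real s)) * cinner (T s (S 0 x)) y"
  shows "cmod (e s - e r) \<le> (fact (Suc m) * t ^ Suc m * (K * (2 * B + 1) * norm x * norm y)) * \<bar>s - r\<bar>"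
proof -
  let ?a = "1 / t"
  let ?C = "fact (Suc m) * t ^ Suc m * (K * (2 * B + 1) * norm x * norm y)"
  let ?E = "\<lambda>k s u. of_real (s ^ k) * exp (- (of_real ?a * of_real s)) * cinner (T s u) y"
  define e' where "e' = (\<lambda>s. of_nat (Suc m) * ?E m s (S 0 x) - of_real ?a * ?E (Suc m) s (S 0 x) - ?E (Suc m) s x)"
  have d: "(e has_vector_derivative e' s) (at s within {0..})" if s: "0 \<le> s" for s
  proof -
    have dc: "((\<lambda>s. cinner (T s (S 0 x)) y) has_vector_derivative - cinner (T s x) y) (at s within {0..})"
      using bounded_linear.has_vector_derivative[OF bounded_linear_cinner_left[where b=y] T_derivative[OF S_in_D[of 0 x] s]]
      by (simp add: A_S0 cinner_simps)
    have de: "((\<lambda>s. exp (- (complex_of_real ?a * of_real s))) has_vector_derivative - of_real ?a * exp (- (of_real ?a * of_real s))) (at s within {0..})"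
      by (rule has_vector_derivative_real_field) (use t in \<open>auto intro!: derivative_eq_intros\<close>)
    have dp: "((\<lambda>s. complex_of_real (s ^ Suc m)) has_vector_derivative of_nat (Suc m) * of_real (s ^ m)) (at s within {0..})"
      unfolding of_real_power
      by (rule has_vector_derivative_real_field, rule DERIV_cong[OF DERIV_power_Suc[OF DERIV_ident]]) simp
    show ?thesis
      unfolding e_def e'_def
      by (rule has_vector_derivative_eq_rhs[OF has_vector_derivative_mult[OF has_vector_derivative_mult[OF dp de] dc]])
        (simp add: algebra_simps)
  qed
  have E: "cmod (?E k s u) \<le> K * norm u * norm y * (fact k * t ^ k)" if "0 \<le> s" for k s u
  proof -
    have "cmod (?E k s u) \<le> K * norm u * norm y * (s ^ k * exp (- (?a * s)))"
      using norm_weighted_orbit_le[OF that, of k "of_real ?a" u y] by simp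
    also have "\<dots> \<le> K * norm u * norm y * (fact k * t ^ k)"
      using power_exp_decay_le[of t s k] t that K_ge_1 by (intro mult_left_mono) auto
    finally show ?thesis .
  qed
  have e'_le: "cmod (e' s) \<le> ?C" if s: "0 \<le> s" for s
  proof -
    let ?U = "K * (B * norm x) * norm y"
    have u: "K * norm (S 0 x) * norm y \<le> ?U"
      using B(1)[of x] K_ge_1 by (intro mult_right_mono mult_left_mono) auto
    have Eu: "cmod (?E k s (S 0 x)) \<le> ?U * (fact k * t ^ k)" for k
      by (rule order_trans[OF E[OF s] mult_right_mono[OF u]]) (use t in simp)
    have 1: "cmod (of_nat (Suc m) * ?E m s (S 0 x)) \<le> fact (Suc m) * t ^ Suc m * ?U"
    proof -
      have "cmod (?E m s (S 0 x)) \<le> ?U * (fact m * t ^ m)" by (rule Eu)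
      also have "\<dots> \<le> ?U * (fact m * t ^ Suc m)"
        using K_ge_1 B(2) t by (intro mult_left_mono power_increasing) auto
      finally have "real (Suc m) * cmod (?E m s (S 0 x)) \<le> real (Suc m) * (?U * (fact m * t ^ Suc m))"
        by (intro mult_left_mono) auto
      also have "\<dots> = fact (Suc m) * t ^ Suc m * ?U" by (simp add: algebra_simps)
      finally show ?thesis by (simp only: norm_mult norm_of_nat)
    qed
    have 2: "cmod (of_real ?a * ?E (Suc m) s (S 0 x)) \<le> fact (Suc m) * t ^ Suc m * ?U"
    proof -
      have "cmod (?E (Suc m) s (S 0 x)) \<le> ?U * (fact (Suc m) * t ^ Suc m)" by (rule Eu)
      moreover have "?a * cmod (?E (Suc m) s (S 0 x)) \<le> 1 * cmod (?E (Suc m) s (S 0 x))"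
        using t by (intro mult_right_mono) auto
      moreover have "cmod (of_real ?a * ?E (Suc m) s (S 0 x)) = ?a * cmod (?E (Suc m) s (S 0 x))"
        using t by (simp only: norm_mult norm_of_real) simp
      ultimately show ?thesis by (simp add: mult_ac)
    qed
    have 3: "cmod (?E (Suc m) s x) \<le> fact (Suc m) * t ^ Suc m * (K * norm x * norm y)"
      using E[OF s, of "Suc m" x] by (simp add: mult_ac)
    have "cmod (e' s) \<le> cmod (of_nat (Suc m) * ?E m s (S 0 x)) + cmod (of_real ?a * ?E (Suc m) s (S 0 x)) + cmod (?E (Suc m) s x)"
      unfolding e'_def by (intro order_trans[OF norm_triangle_ineq4] add_mono order_refl)
    also have "\<dots> \<le> fact (Suc m) * t ^ Suc m * ?U + fact (Suc m) * t ^ Suc m * ?U + fact (Suc m) * t ^ Suc m * (K * norm x * norm y)"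
      by (intro add_mono 1 2 3)
    also have "\<dots> = ?C" by (simp add: algebra_simps)
    finally show ?thesis .
  qed
  have "norm (e s - e r) \<le> ?C * norm (s - r)"
  proof (rule differentiable_bound[of "{0..}"])
    show "(e has_derivative (\<lambda>h. h *\<^sub>R e' s)) (at s within {0..})" if "s \<in> {0..}" for s
      using d that by (simp add: has_vector_derivative_def)
    show "onorm (\<lambda>h. h *\<^sub>R e' s) \<le> ?C" if "s \<in> {0..}" for s
      using e'_le[of s] that by (intro onorm_le) (simp add: mult.commute mult_left_mono)
  qed (use s in auto)
  then show ?thesis by simp
qed

text \<open>
  The hypothesis on the growth says that, within the frequency range seen by a Gaussian of width \<open>R\<close>, the
  power \<open>Suc j\<close> of the resolvent norm divided by \<open>1 + \<bar>\<xi>\<bar>\<close> is no larger than it should be at the edge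
  \<open>R\<close>, where the resolvent norm is of order \<open>t\<close>. The weight \<open>s ^ n\<close> with \<open>n = j + 2\<close> yields \<open>n + 1\<close>
  resolvents, of which two are spent on the two applications of Plancherel.
\<close>

theorem decay_from_resolvent_growth:
  assumes t: "t \<ge> 1" and R: "R > 0"
    and N: "\<And>\<xi> u. norm (S \<xi> u) \<le> N \<xi> * norm u" "\<And>\<xi>. N \<xi> \<ge> 1"
    and B: "\<And>u. norm (S 0 u) \<le> B * norm u" "B \<ge> 0"
    and growth: "\<And>\<xi>. exp (- (\<xi>\<^sup>2 / (2 * R\<^sup>2))) * (N \<xi> ^ Suc j / (1 + \<bar>\<xi>\<bar>)) \<le> Q * t ^ Suc j / R"
  shows "norm (T t (S 0 x)) \<le> exp 1 * fact (Suc (Suc j)) * (K * (2 * B + 1)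
      + K\<^sup>2 * ((1 + K) ^ j * (B + (1 + K) * (1 + B))) * Q) / R * norm x"
proof (cases "x = 0")
  case True
  then show ?thesis using t by (simp add: linear_0[OF bounded_linear.linear[OF bounded_linear_S]]
    linear_0[OF bounded_linear.linear[OF bounded_linear_T]])
next
  case x: False
  define a where "a = 1 / t"
  have a: "a > 0" using t by (simp add: a_def)
  define \<sigma> where "\<sigma> = 1 / R"
  have \<sigma>: "\<sigma> > 0" using R by (simp add: \<sigma>_def)
  define n where "n = Suc (Suc j)"
  define u where "u = S 0 x"
  define w where "w = (\<lambda>\<xi>. exp (- (\<sigma>\<^sup>2 * \<xi>\<^sup>2 / 2)))"
  have w_eq: "w \<xi> = exp (- (\<xi>\<^sup>2 / (2 * R\<^sup>2)))" for \<xi> by (simp add: w_def \<sigma>_def power_divide)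
  have w0: "w \<xi> > 0" for \<xi> by (simp add: w_def)
  define L where "L = (\<lambda>\<xi>. laplace (Complex a \<xi>))"
  define p where "p = (\<lambda>\<xi>. (L \<xi> ^^ n) u)"
  define C2 where "C2 = (1 + K) ^ j * (B + (1 + K) * (1 + B))"
  have C2: "C2 > 0" using K_ge_1 B(2) by (simp add: C2_def add_nonneg_pos)
  define E where "E = C2 * (Q * t ^ Suc j / R)"
  have "0 < exp (- ((0::real)\<^sup>2 / (2 * R\<^sup>2))) * (N 0 ^ Suc j / (1 + \<bar>0\<bar>))"
    using N(2)[of 0] by (intro mult_pos_pos divide_pos_pos zero_less_power) auto
  then have Qpos: "0 < Q * t ^ Suc j / R" using growth[of 0] by linarith
  have E: "E > 0" unfolding E_def by (rule mult_pos_pos[OF C2 Qpos])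
  have p_cont: "continuous_on UNIV p" unfolding p_def L_def by (rule continuous_on_laplace_power[OF a])
  have p_le: "norm (p \<xi>) \<le> (K / a) ^ n * norm u" for \<xi>
    unfolding p_def L_def using norm_laplace_le[of "Complex a \<xi>"] a K_ge_1 by (intro norm_laplace_power_le) auto
  define g where "g = (\<lambda>\<xi>. E * norm (L \<xi> x))"
  have p_g: "exp (- (\<sigma>\<^sup>2 * \<xi>\<^sup>2 / 2)) * norm (p \<xi>) \<le> g \<xi>" for \<xi>
  proof -
    have "norm (p \<xi>) \<le> C2 * (N \<xi> ^ Suc j / (1 + \<bar>\<xi>\<bar>)) * norm (L \<xi> x)"
      unfolding p_def L_def n_def u_def C2_def by (rule norm_laplace_power_S0_le[OF a N B])
    then have "w \<xi> * norm (p \<xi>) \<le> w \<xi> * (C2 * (N \<xi> ^ Suc j / (1 + \<bar>\<xi>\<bar>)) * norm (L \<xi> x))"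
      using w0[of \<xi>] by (intro mult_left_mono) auto
    also have "\<dots> = C2 * (w \<xi> * (N \<xi> ^ Suc j / (1 + \<bar>\<xi>\<bar>))) * norm (L \<xi> x)" by simp
    also have "\<dots> \<le> g \<xi>"
      unfolding g_def E_def using growth[of \<xi>] C2 by (intro mult_right_mono mult_left_mono) (auto simp: w_eq)
    finally show ?thesis by (simp add: w_def)
  qed
  have g_meas: "g \<in> borel_measurable borel"
    unfolding g_def L_def
    by (intro borel_measurable_continuous_onI continuous_intros continuous_on_laplace[OF a])
  have g2: "integrable lborel (\<lambda>\<xi>. (g \<xi>)\<^sup>2)"
    using Plancherel_laplace(1)[OF a, of x] by (simp add: g_def L_def power_mult_distrib)
  define G where "G = E * (sqrt pi * K * norm x)"
  have G: "G > 0" using E K_ge_1 x by (simp add: G_def)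
  have g2_le: "(LBINT \<xi>. (g \<xi>)\<^sup>2) \<le> G\<^sup>2 * t"
  proof -
    have "(LBINT \<xi>. (g \<xi>)\<^sup>2) = E\<^sup>2 * (LBINT \<xi>. (norm (L \<xi> x))\<^sup>2)" by (simp add: g_def power_mult_distrib)
    also have "\<dots> \<le> E\<^sup>2 * (pi * (K * norm x)\<^sup>2 / a)"
      unfolding L_def by (intro mult_left_mono Plancherel_laplace(2)[OF a]) simp
    also have "\<dots> = G\<^sup>2 * t" by (simp add: G_def a_def power_mult_distrib)
    finally show ?thesis .
  qed
  \<comment> \<open>Testing against this vector turns the estimate into one for its norm.\<close>
  define y where "y = T t u"
  have t0: "t > 0" using t by simp
  define J where "J = (LBINT \<xi>. of_real (w \<xi>) * exp (\<i> * of_real (\<xi> * t)) * cinner (L \<xi> (p \<xi>)) y)"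
  have J: "cmod J \<le> sqrt (2 * pi) * K * G * t * norm y"
    unfolding J_def w_def L_def a_def
    by (rule norm_oscillatory_laplace_le[OF t0 \<sigma> p_cont p_le p_g g_meas g2 g2_le G])
  define \<phi> where "\<phi> = (\<lambda>s. indicator {0..} s *\<^sub>R (of_real (s ^ n) * exp (- (of_real a * of_real s)) * cinner (T s u) y))"
  define Lp where "Lp = fact n * t ^ n * (K * (2 * B + 1) * norm x * norm y)"
  have Lp: "Lp \<ge> 0" using K_ge_1 B(2) t by (simp add: Lp_def)
  have lip: "cmod (\<phi> t - \<phi> s) \<le> Lp * \<bar>s - t\<bar>" for s
  proof (cases "0 \<le> s")
    case True
    then show ?thesis
      using weighted_orbit_Lipschitz[OF t B _ True, of t "Suc j" x y] t
      by (simp add: \<phi>_def Lp_def n_def u_def a_def abs_minus_commute del: fact_Suc power_Suc)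
  next
    case False
    have "cmod (\<phi> t - \<phi> 0) \<le> Lp * \<bar>t - 0\<bar>"
      using weighted_orbit_Lipschitz[OF t B, of t 0 "Suc j" x y] t
      by (simp add: \<phi>_def Lp_def n_def u_def a_def del: fact_Suc power_Suc)
    also have "\<phi> 0 = \<phi> s" using False by (simp add: \<phi>_def n_def)
    also have "Lp * \<bar>t - 0\<bar> \<le> Lp * \<bar>s - t\<bar>" using False t Lp by (intro mult_left_mono) auto
    finally show ?thesis .
  qed
  have \<phi>_int: "integrable lborel \<phi>" unfolding \<phi>_def using a by (intro weak_lap_integrable) simp
  define H where "H = (\<lambda>\<xi> s. of_real (w \<xi>) * exp (\<i> * of_real (\<xi> * (t - s))) * \<phi> s)"
  have H_int: "integrable (lborel \<Otimes>\<^sub>M lborel) (\<lambda>(\<xi>, s). H \<xi> s)"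
  proof (rule Bochner_Integration.integrable_bound)
    show "integrable (lborel \<Otimes>\<^sub>M lborel) (\<lambda>(\<xi>, s). w \<xi> * cmod (\<phi> s))"
      unfolding w_def by (intro integrable_tensor Fourier_gaussian(1)[OF \<sigma>] integrable_norm \<phi>_int)
    have [measurable]: "\<phi> \<in> borel_measurable borel" using borel_measurable_integrable[OF \<phi>_int] by simp
    show "(\<lambda>(\<xi>, s). H \<xi> s) \<in> borel_measurable (lborel \<Otimes>\<^sub>M lborel)"
      unfolding H_def w_def by measurable
  qed (auto simp: H_def norm_mult w_def)
  \<comment> \<open>Integrated over frequencies first, \<open>H\<close> gives the Gaussian average; over times first, the resolvents.\<close>
  have inner1: "(LBINT \<xi>. H \<xi> s) = 2 * pi * (of_real (normal_density t \<sigma> s) * \<phi> s)" for s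
  proof -
    have "(LBINT \<xi>. H \<xi> s) = of_real (2 * pi * normal_density 0 \<sigma> (t - s)) * \<phi> s"
      unfolding H_def w_def by (simp only: integral_mult_left_zero Fourier_gaussian(2)[OF \<sigma>])
    also have "normal_density 0 \<sigma> (t - s) = normal_density t \<sigma> s"
      by (simp add: normal_density_def power2_commute)
    finally show ?thesis by simp
  qed
  have inner2: "(LBINT s. H \<xi> s) = fact n * (of_real (w \<xi>) * exp (\<i> * of_real (\<xi> * t)) * cinner (L \<xi> (p \<xi>)) y)" for \<xi>
  proof -
    have "(LBINT s. H \<xi> s) = (LBINT s. of_real (w \<xi>) * exp (\<i> * of_real (\<xi> * t)) *
        (indicator {0..} s *\<^sub>R (of_real (s ^ n) * exp (- (Complex a \<xi> * of_real s)) * cinner (T s u) y)))"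
    proof (rule Bochner_Integration.integral_cong[OF refl])
      fix s
      have ee: "exp (\<i> * of_real (\<xi> * (t - s))) * exp (- (of_real a * of_real s)) = exp (\<i> * of_real (\<xi> * t)) * exp (- (Complex a \<xi> * of_real s))"
        by (simp add: Complex_eq algebra_simps flip: exp_add)
      have "exp (\<i> * of_real (\<xi> * (t - s))) * (of_real (s ^ n) * exp (- (of_real a * of_real s)) * cinner (T s u) y)
        = exp (\<i> * of_real (\<xi> * t)) * (of_real (s ^ n) * exp (- (Complex a \<xi> * of_real s)) * cinner (T s u) y)"
        using arg_cong[OF ee, of "\<lambda>v. v * (of_real (s ^ n) * cinner (T s u) y)"] by (simp only: mult_ac)
      then show "H \<xi> s = of_real (w \<xi>) * exp (\<i> * of_real (\<xi> * t)) *
        (indicator {0..} s *\<^sub>R (of_real (s ^ n) * exp (- (Complex a \<xi> * of_real s)) * cinner (T s u) y))"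
        by (simp add: H_def \<phi>_def mult.assoc del: of_real_mult)
    qed
    also have "\<dots> = of_real (w \<xi>) * exp (\<i> * of_real (\<xi> * t)) * weak_lap n (Complex a \<xi>) u y"
      by (simp only: integral_mult_right_zero weak_lap_def)
    also have "\<dots> = fact n * (of_real (w \<xi>) * exp (\<i> * of_real (\<xi> * t)) * cinner (L \<xi> (p \<xi>)) y)"
      by (simp add: weak_lap_eq_power[OF a] L_def p_def)
    finally show ?thesis .
  qed
  have avg: "2 * pi * (LBINT s. of_real (normal_density t \<sigma> s) * \<phi> s) = fact n * J"
    using lborel_pair.Fubini_integral[OF H_int] by (simp add: inner1 inner2 J_def)
  have avg_int: "integrable lborel (\<lambda>s. of_real (normal_density t \<sigma> s) * \<phi> s)"
    using integrable_mult_right[OF lborel_pair.integrable_snd[OF H_int], of "1 / (2 * of_real pi)"] by (simp add: inner1)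
  have "cmod (LBINT s. of_real (normal_density t \<sigma> s) * \<phi> s) = fact n / (2 * pi) * cmod J"
    using arg_cong[OF avg, of cmod] by (simp add: norm_mult field_simps)
  also have "\<dots> \<le> fact n / (2 * pi) * (sqrt (2 * pi) * K * G * t * norm y)"
    by (intro mult_left_mono J) simp
  also have "\<dots> \<le> fact n / (2 * pi) * (2 * pi * K * (E * K * norm x) * t * norm y)"
  proof -
    have "sqrt (2 * pi) * sqrt pi \<le> sqrt (2 * pi) * sqrt (2 * pi)" by (intro mult_left_mono) auto
    then have "sqrt (2 * pi) * sqrt pi \<le> 2 * pi" by simp
    then have "(sqrt (2 * pi) * sqrt pi) * (K * (E * K * norm x) * t * norm y) \<le> 2 * pi * (K * (E * K * norm x) * t * norm y)"
      using K_ge_1 E t by (intro mult_right_mono) auto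
    then show ?thesis unfolding G_def by (intro mult_left_mono) (auto simp: mult_ac)
  qed
  also have "\<dots> = fact n * K\<^sup>2 * E * t * norm x * norm y" by (simp add: power2_eq_square)
  also have "\<dots> = fact n * t ^ n * (K\<^sup>2 * C2 * Q * norm x * norm y) * \<sigma>"
    by (simp add: E_def n_def \<sigma>_def)
  finally have "cmod (\<phi> t) \<le> Lp * \<sigma> + fact n * t ^ n * (K\<^sup>2 * C2 * Q * norm x * norm y) * \<sigma>"
    using gaussian_average_le[OF \<sigma> lip avg_int Lp] by linarith
  also have "\<dots> = t ^ n * (fact n * (K * (2 * B + 1) + K\<^sup>2 * C2 * Q) * \<sigma> * norm x) * norm y"
    by (simp add: Lp_def algebra_simps)
  also have "cmod (\<phi> t) = t ^ n * (exp (- 1) * norm y) * norm y"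
    using t by (simp add: \<phi>_def a_def y_def cinner_self norm_mult power2_eq_square norm_power)
  finally have "norm y * (t ^ n * (exp (- 1) * norm y)) \<le> norm y * (t ^ n * (fact n * (K * (2 * B + 1) + K\<^sup>2 * C2 * Q) * \<sigma> * norm x))"
    by (simp add: mult_ac)
  then have "exp (- 1) * norm y \<le> fact n * (K * (2 * B + 1) + K\<^sup>2 * C2 * Q) * \<sigma> * norm x" if "y \<noteq> 0"
    using that t by (simp add: mult_le_cancel_left_pos)
  moreover have "0 \<le> Q" using Qpos R zero_less_power[of t "Suc j"] t
    by (simp add: zero_less_divide_iff zero_less_mult_iff del: power_Suc)
  ultimately have "exp (- 1) * norm y \<le> fact n * (K * (2 * B + 1) + K\<^sup>2 * C2 * Q) * \<sigma> * norm x"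
    using K_ge_1 B(2) C2 \<sigma> by (cases "y = 0") auto
  then have "exp 1 * (exp (- 1) * norm y) \<le> exp 1 * (fact n * (K * (2 * B + 1) + K\<^sup>2 * C2 * Q) * \<sigma> * norm x)"
    by (intro mult_left_mono) auto
  then show ?thesis
    by (simp add: y_def u_def n_def C2_def \<sigma>_def mult.assoc[symmetric] flip: exp_add del: fact_Suc)
qed

end

section \<open>Regularly varying growth\<close>

text \<open>
  Potter's bound in the form needed here: for a monotone function, slow variation along the ratio \<open>2\<close>
  suffices, by iterating it over the dyadic steps from \<open>R\<close> to \<open>s\<close>.
\<close>

lemma doubling_le_linear:
  fixes l :: "real \<Rightarrow> real"
  assumes s0: "s0 > 0" and pos: "\<And>s. s0 \<le> s \<Longrightarrow> 0 < l s" and anti: "antimono_on {s0..} l"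
    and dbl: "\<And>s. s0 \<le> s \<Longrightarrow> l s \<le> 2 * l (2 * s)" and R: "s0 \<le> R" "R \<le> s"
  shows "l R \<le> 2 * (s / R) * l s"
proof -
  have it: "l R \<le> 2 ^ i * l (2 ^ i * R)" for i :: nat
  proof (induction i)
    case (Suc i)
    have "s0 \<le> 2 ^ i * R"
      using R(1) s0 mult_mono[of 1 "2 ^ i" s0 R] by simp
    from dbl[OF this] have "2 ^ i * l (2 ^ i * R) \<le> 2 ^ i * (2 * l (2 * (2 ^ i * R)))"
      by (intro mult_left_mono) auto
    from order_trans[OF Suc this] show ?case by (simp add: mult_ac)
  qed simp
  have R0: "R > 0" using s0 R by simp
  have "\<exists>i. s \<le> 2 ^ i * R"
  proof -
    obtain i :: nat where "s / R < 2 ^ i" using real_arch_pow[of 2 "s / R"] by auto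
    then show ?thesis using R0 by (auto simp: pos_divide_less_eq intro!: exI[of _ i])
  qed
  then obtain i where i: "s \<le> 2 ^ i * R" "\<And>j. j < i \<Longrightarrow> \<not> s \<le> 2 ^ j * R"
    using exists_least_iff[of "\<lambda>i. s \<le> 2 ^ i * R"] by blast
  have "2 ^ i \<le> 2 * (s / R)"
  proof (cases i)
    case 0
    then show ?thesis using R R0 by (simp add: pos_le_divide_eq)
  next
    case (Suc j)
    then have "2 ^ j * R < s" using i(2)[of j] by simp
    then show ?thesis using Suc R0 by (simp add: pos_le_divide_eq)
  qed
  moreover have "l (2 ^ i * R) \<le> l s"
    using monotone_onD[OF anti, of s "2 ^ i * R"] i(1) R by auto
  ultimately have "2 ^ i * l (2 ^ i * R) \<le> 2 * (s / R) * l s"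
    using pos[of "2 ^ i * R"] i(1) R R0 by (intro mult_mono) auto
  with it[of i] show ?thesis by linarith
qed

text \<open>
  Let \<open>M s = s powr \<alpha> / l s\<close>. For frequencies between \<open>s0\<close> and \<open>R\<close> monotonicity of \<open>l\<close> gives
  \<open>M \<xi> \<le> (\<xi> / R) powr \<alpha> * M R\<close>, and the exponent \<open>m * \<alpha> \<ge> 1\<close> compensates the denominator. Above \<open>R\<close>,
  \<open>M\<close> exceeds \<open>M R\<close> by at most a power of \<open>\<xi> / R\<close>, which the Gaussian absorbs. Below \<open>s0\<close> everything is
  bounded, while \<open>M R ^ m / R\<close> is bounded below, again since \<open>m * \<alpha> \<ge> 1\<close>.
\<close>

lemma regularly_varying_growth:
  fixes l :: "real \<Rightarrow> real" and m :: nat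
  assumes \<alpha>: "\<alpha> > 0" "real m * \<alpha> \<ge> 1" and s0: "s0 \<ge> 1"
    and pos: "\<And>s. s0 \<le> s \<Longrightarrow> 0 < l s" and anti: "antimono_on {s0..} l"
    and dbl: "\<And>s. s0 \<le> s \<Longrightarrow> l s \<le> 2 * l (2 * s)" and C: "C \<ge> 0" "C0 \<ge> 0"
  shows "\<exists>Q. \<forall>R t \<xi>. s0 \<le> R \<longrightarrow> R powr \<alpha> / l R \<le> 2 * t \<longrightarrow>
     exp (- (\<xi>\<^sup>2 / (2 * R\<^sup>2))) * ((if \<bar>\<xi>\<bar> < s0 then C0 else C * (\<bar>\<xi>\<bar> powr \<alpha> / l \<bar>\<xi>\<bar>)) ^ m / (1 + \<bar>\<xi>\<bar>))
       \<le> Q * t ^ m / R"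
proof -
  define j where "j = nat \<lceil>1 + \<alpha>\<rceil>"
  have j: "1 + \<alpha> \<le> real j" unfolding j_def by (rule real_nat_ceiling_ge)
  define k where "k = j * m"
  define Q1 where "Q1 = C0 ^ m * (2 * l s0) ^ m"
  define Q2 where "Q2 = (2 * C) ^ m"
  define Q3 where "Q3 = (4 * C) ^ m * (fact k * 2 ^ k)"
  have ls0: "l s0 > 0" using pos by simp
  have Q_nonneg: "Q1 \<ge> 0" "Q2 \<ge> 0" "Q3 \<ge> 0" using C ls0 by (simp_all add: Q1_def Q2_def Q3_def)
  have main: "exp (- (\<xi>\<^sup>2 / (2 * R\<^sup>2))) * ((if \<bar>\<xi>\<bar> < s0 then C0 else C * (\<bar>\<xi>\<bar> powr \<alpha> / l \<bar>\<xi>\<bar>)) ^ m / (1 + \<bar>\<xi>\<bar>))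
       \<le> (Q1 + Q2 + Q3) * t ^ m / R" if R: "s0 \<le> R" and tR: "R powr \<alpha> / l R \<le> 2 * t" for R t \<xi>
  proof -
    define M where "M = (\<lambda>s. s powr \<alpha> / l s)"
    have R1: "R \<ge> 1" using R s0 by simp
    have lR: "l R > 0" using pos R by simp
    have MR: "0 < M R" "M R \<le> 2 * t" using lR tR R1 by (auto simp: M_def)
    then have t: "t > 0" by simp
    have MRm: "M R ^ m \<le> (2 * t) ^ m" using MR by (intro power_mono) auto
    have w1: "exp (- (\<xi>\<^sup>2 / (2 * R\<^sup>2))) \<le> 1" by simp
    have R_le: "R \<le> (R powr \<alpha>) ^ m"
    proof -
      have "R = R powr 1" using R1 by simp
      also have "\<dots> \<le> R powr (\<alpha> * real m)" using R1 \<alpha> by (intro powr_mono) (auto simp: mult.commute)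
      also have "\<dots> = (R powr \<alpha>) ^ m" using R1 by (simp add: powr_powr[symmetric] powr_realpow)
      finally show ?thesis .
    qed
    consider (low) "\<bar>\<xi>\<bar> < s0" | (mid) "s0 \<le> \<bar>\<xi>\<bar>" "\<bar>\<xi>\<bar> \<le> R" | (high) "R \<le> \<bar>\<xi>\<bar>" by linarith
    then have "exp (- (\<xi>\<^sup>2 / (2 * R\<^sup>2))) * ((if \<bar>\<xi>\<bar> < s0 then C0 else C * M \<bar>\<xi>\<bar>) ^ m / (1 + \<bar>\<xi>\<bar>))
       \<le> Q1 * t ^ m / R \<or> exp (- (\<xi>\<^sup>2 / (2 * R\<^sup>2))) * ((if \<bar>\<xi>\<bar> < s0 then C0 else C * M \<bar>\<xi>\<bar>) ^ m / (1 + \<bar>\<xi>\<bar>))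
       \<le> Q2 * t ^ m / R \<or> exp (- (\<xi>\<^sup>2 / (2 * R\<^sup>2))) * ((if \<bar>\<xi>\<bar> < s0 then C0 else C * M \<bar>\<xi>\<bar>) ^ m / (1 + \<bar>\<xi>\<bar>))
       \<le> Q3 * t ^ m / R"
    proof cases
      case low
      have "R / l s0 ^ m \<le> (R powr \<alpha>) ^ m / l R ^ m"
        using R_le lR monotone_onD[OF anti, of s0 R] R by (intro frac_le power_mono) auto
      also have "\<dots> = M R ^ m" by (simp add: M_def power_divide)
      also note MRm
      finally have "1 \<le> (2 * l s0) ^ m * t ^ m / R"
        using R1 ls0 by (simp add: pos_divide_le_eq pos_le_divide_eq power_mult_distrib mult_ac)
      then have *: "C0 ^ m * 1 \<le> C0 ^ m * ((2 * l s0) ^ m * t ^ m / R)" using C by (intro mult_left_mono) auto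
      have "exp (- (\<xi>\<^sup>2 / (2 * R\<^sup>2))) * (C0 ^ m / (1 + \<bar>\<xi>\<bar>)) \<le> 1 * (C0 ^ m / 1)"
        using C by (intro mult_mono frac_le w1) auto
      also have "\<dots> \<le> Q1 * t ^ m / R" using * by (simp add: Q1_def)
      finally show ?thesis using low by simp
    next
      case mid
      define \<rho> where "\<rho> = \<bar>\<xi>\<bar> / R"
      have \<xi>: "\<bar>\<xi>\<bar> > 0" using mid s0 by simp
      have \<rho>: "0 < \<rho>" "\<rho> \<le> 1" "\<bar>\<xi>\<bar> = \<rho> * R" using mid R1 \<xi> by (auto simp: \<rho>_def)
      have lx: "l R \<le> l \<bar>\<xi>\<bar>" using monotone_onD[OF anti, of "\<bar>\<xi>\<bar>" R] mid by auto
      have "M \<bar>\<xi>\<bar> \<le> \<bar>\<xi>\<bar> powr \<alpha> / l R" unfolding M_def using lx lR by (intro divide_left_mono) (auto intro: mult_pos_pos)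
      also have "\<dots> = \<rho> powr \<alpha> * M R" using \<rho> R1 by (simp add: M_def powr_mult)
      finally have "M \<bar>\<xi>\<bar> ^ m \<le> (\<rho> powr \<alpha> * M R) ^ m"
        using pos mid(1) by (intro power_mono) (auto simp: M_def less_imp_le)
      also have "\<dots> = \<rho> powr (\<alpha> * real m) * M R ^ m"
        using \<rho> by (simp add: power_mult_distrib powr_powr[symmetric] powr_realpow)
      also have "\<dots> \<le> \<rho> powr 1 * (2 * t) ^ m"
        using \<rho> \<alpha> MRm MR by (intro mult_mono powr_mono') (auto simp: mult.commute)
      finally have Mm: "M \<bar>\<xi>\<bar> ^ m \<le> \<rho> * (2 * t) ^ m" using \<rho> by simp
      have Mx: "0 \<le> M \<bar>\<xi>\<bar>" using pos[OF mid(1)] by (simp add: M_def)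
      have "exp (- (\<xi>\<^sup>2 / (2 * R\<^sup>2))) * ((C * M \<bar>\<xi>\<bar>) ^ m / (1 + \<bar>\<xi>\<bar>)) \<le> 1 * ((C ^ m * (\<rho> * (2 * t) ^ m)) / \<bar>\<xi>\<bar>)"
        using C Mx \<xi> Mm t \<rho> unfolding power_mult_distrib[of C]
        by (intro mult_mono frac_le w1 mult_left_mono) auto
      also have "\<dots> = Q2 * t ^ m / R" using \<rho>(1) R1 by (simp add: \<rho>(3) Q2_def power_mult_distrib)
      finally show ?thesis using mid by simp
    next
      case high
      define \<rho> where "\<rho> = \<bar>\<xi>\<bar> / R"
      have \<xi>: "\<bar>\<xi>\<bar> > 0" using high R1 by simp
      have \<rho>: "1 \<le> \<rho>" "\<bar>\<xi>\<bar> = \<rho> * R" using high R1 by (auto simp: \<rho>_def)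
      have lx: "0 < l \<bar>\<xi>\<bar>" using pos high R by simp
      have "l R \<le> 2 * \<rho> * l \<bar>\<xi>\<bar>"
        unfolding \<rho>_def using s0 R high by (intro doubling_le_linear[OF _ pos anti dbl]) auto
      then have "1 / l \<bar>\<xi>\<bar> \<le> 2 * \<rho> / l R" using lx lR by (simp add: field_simps)
      then have "\<bar>\<xi>\<bar> powr \<alpha> * (1 / l \<bar>\<xi>\<bar>) \<le> \<bar>\<xi>\<bar> powr \<alpha> * (2 * \<rho> / l R)" by (intro mult_left_mono) auto
      then have "M \<bar>\<xi>\<bar> \<le> 2 * (\<rho> * \<rho> powr \<alpha>) * M R"
        using \<rho> R1 by (simp add: M_def powr_mult mult_ac)
      also have "\<rho> * \<rho> powr \<alpha> = \<rho> powr (1 + \<alpha>)" using \<rho> by (simp add: powr_add)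
      also have "\<rho> powr (1 + \<alpha>) \<le> \<rho> powr real j" using \<rho> j by (intro powr_mono) auto
      also have "\<dots> = \<rho> ^ j" using \<rho> by (simp add: powr_realpow)
      finally have "M \<bar>\<xi>\<bar> \<le> 2 * \<rho> ^ j * M R" using MR by (simp add: mult_right_mono)
      then have "M \<bar>\<xi>\<bar> ^ m \<le> (2 * \<rho> ^ j * M R) ^ m" using lx by (intro power_mono) (auto simp: M_def)
      also have "\<dots> = 2 ^ m * \<rho> ^ k * M R ^ m" by (simp add: power_mult_distrib k_def power_mult)
      also have "\<dots> \<le> 2 ^ m * (\<rho>\<^sup>2) ^ k * (2 * t) ^ m"
        using \<rho> MRm MR unfolding power_mult[symmetric] by (intro mult_mono power_increasing) auto
      finally have Mm: "M \<bar>\<xi>\<bar> ^ m \<le> 2 ^ m * (\<rho>\<^sup>2) ^ k * (2 * t) ^ m" .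
      have g: "(\<rho>\<^sup>2) ^ k * exp (- (1 / 2 * \<rho>\<^sup>2)) \<le> fact k * 2 ^ k" by (rule power_exp_decay_le) auto
      have w: "exp (- (\<xi>\<^sup>2 / (2 * R\<^sup>2))) = exp (- (1 / 2 * \<rho>\<^sup>2))" by (simp add: \<rho>_def power_divide)
      have "exp (- (\<xi>\<^sup>2 / (2 * R\<^sup>2))) * ((C * M \<bar>\<xi>\<bar>) ^ m / (1 + \<bar>\<xi>\<bar>))
         \<le> exp (- (1 / 2 * \<rho>\<^sup>2)) * ((C ^ m * (2 ^ m * (\<rho>\<^sup>2) ^ k * (2 * t) ^ m)) / R)"
      proof -
        have "C ^ m * M \<bar>\<xi>\<bar> ^ m / (1 + \<bar>\<xi>\<bar>) \<le> C ^ m * (2 ^ m * (\<rho>\<^sup>2) ^ k * (2 * t) ^ m) / R"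
        proof (rule frac_le)
          show "C ^ m * M \<bar>\<xi>\<bar> ^ m \<le> C ^ m * (2 ^ m * (\<rho>\<^sup>2) ^ k * (2 * t) ^ m)"
            using C(1) by (intro mult_left_mono Mm) simp
          show "0 \<le> C ^ m * (2 ^ m * (\<rho>\<^sup>2) ^ k * (2 * t) ^ m)" using C(1) t by simp
        qed (use R1 high in linarith)+
        then show ?thesis
          unfolding w power_mult_distrib[of C "M \<bar>\<xi>\<bar>"] by (intro mult_left_mono) simp_all
      qed
      also have "\<dots> = (4 * C) ^ m * ((\<rho>\<^sup>2) ^ k * exp (- (1 / 2 * \<rho>\<^sup>2))) * t ^ m / R"
      proof -
        have "4 * C = C * 2 * 2" by simp
        then have 4: "(4 * C) ^ m = C ^ m * 2 ^ m * 2 ^ m" by (simp only: power_mult_distrib)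
        have "e * (c * (p * x * (p * y)) / R) = c * p * p * (x * e) * y / R" for e c p x y :: real by simp
        then show ?thesis by (simp only: 4 power_mult_distrib[of 2 t])
      qed
      also have "\<dots> \<le> (4 * C) ^ m * (fact k * 2 ^ k) * t ^ m / R"
        using C t R1 by (intro divide_right_mono mult_right_mono mult_left_mono g) auto
      finally show ?thesis using high R by (simp add: Q3_def)
    qed
    moreover have "Q1 * t ^ m / R \<le> (Q1 + Q2 + Q3) * t ^ m / R" "Q2 * t ^ m / R \<le> (Q1 + Q2 + Q3) * t ^ m / R"
      "Q3 * t ^ m / R \<le> (Q1 + Q2 + Q3) * t ^ m / R"
      using Q_nonneg t R1 by (auto intro!: divide_right_mono mult_right_mono)
    ultimately show ?thesis unfolding M_def by linarith
  qed
  then show ?thesis by (intro exI[of _ "Q1 + Q2 + Q3"]) blast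
qed

context imaginary_resolvent_semigroup
begin

lemma norm_S_le: "norm (S \<xi> u) \<le> onorm (S \<xi>) * norm u"
  using onorm[OF bounded_linear_S] by simp

text \<open>
  The resolvent identity, with the term containing \<open>S \<eta>\<close> absorbed on the left.
\<close>

lemma S_locally_bounded:
  assumes "\<bar>\<xi> - \<eta>\<bar> * onorm (S \<xi>) \<le> 1 / 2"
  shows "norm (S \<eta> u) \<le> 2 * onorm (S \<xi>) * norm u"
proof -
  let ?x = "S \<eta> u" and ?d = "\<i> * complex_of_real (\<xi> - \<eta>)"
  have "(\<i> * of_real \<xi>) *\<^sub>C ?x + A ?x = u + ?d *\<^sub>C ?x"
    using S_right[of \<eta> u] scaleC_add_left[of ?d "\<i> * of_real \<eta>" ?x] by (simp add: algebra_simps)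
  then have "?x = S \<xi> (u + ?d *\<^sub>C ?x)" using S_left[OF S_in_D[of \<eta> u], of \<xi>] by simp
  then have "norm ?x \<le> onorm (S \<xi>) * norm (u + ?d *\<^sub>C ?x)" by (metis norm_S_le)
  also have "\<dots> \<le> onorm (S \<xi>) * (norm u + \<bar>\<xi> - \<eta>\<bar> * norm ?x)"
    using norm_triangle_ineq[of u "?d *\<^sub>C ?x"] onorm_pos_le[OF bounded_linear_S, of \<xi>]
    by (intro mult_left_mono) (auto simp: norm_scaleC norm_mult simp del: of_real_diff)
  also have "\<dots> = onorm (S \<xi>) * norm u + (\<bar>\<xi> - \<eta>\<bar> * onorm (S \<xi>)) * norm ?x" by (simp add: algebra_simps)
  also have "(\<bar>\<xi> - \<eta>\<bar> * onorm (S \<xi>)) * norm ?x \<le> 1 / 2 * norm ?x" by (intro mult_right_mono assms) auto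
  finally show ?thesis by simp
qed

lemma S_bounded_on_compact:
  "\<exists>c\<ge>1. \<forall>\<xi> u. \<bar>\<xi>\<bar> \<le> s \<longrightarrow> norm (S \<xi> u) \<le> c * norm u"
proof -
  define \<delta> where "\<delta> = (\<lambda>\<xi>. 1 / (2 * (onorm (S \<xi>) + 1)))"
  have o: "0 \<le> onorm (S \<xi>)" for \<xi> by (rule onorm_pos_le[OF bounded_linear_S])
  have \<delta>: "\<delta> \<xi> > 0" for \<xi> using o[of \<xi>] by (simp add: \<delta>_def)
  have cover: "{-s..s} \<subseteq> (\<Union>\<xi>\<in>{-s..s}. ball \<xi> (\<delta> \<xi>))"
  proof
    fix \<eta> assume "\<eta> \<in> {-s..s}"
    then show "\<eta> \<in> (\<Union>\<xi>\<in>{-s..s}. ball \<xi> (\<delta> \<xi>))" using \<delta>[of \<eta>] by (intro UN_I[of \<eta>]) auto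
  qed
  obtain F where F: "F \<subseteq> {-s..s}" "finite F" "{-s..s} \<subseteq> (\<Union>\<xi>\<in>F. ball \<xi> (\<delta> \<xi>))"
    by (rule compactE_image[OF compact_Icc open_ball cover])
  define c where "c = 1 + (\<Sum>\<xi>\<in>F. 2 * onorm (S \<xi>))"
  have "c \<ge> 1" using o by (simp add: c_def sum_nonneg)
  moreover have "norm (S \<eta> u) \<le> c * norm u" if "\<bar>\<eta>\<bar> \<le> s" for \<eta> u
  proof -
    have "\<eta> \<in> {-s..s}" using that by auto
    then obtain \<xi> where \<xi>: "\<xi> \<in> F" "dist \<xi> \<eta> < \<delta> \<xi>" using F(3) by auto
    have "\<bar>\<xi> - \<eta>\<bar> * onorm (S \<xi>) \<le> \<delta> \<xi> * onorm (S \<xi>)"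
      using \<xi>(2) o[of \<xi>] by (intro mult_right_mono) (auto simp: dist_real_def)
    also have "\<dots> \<le> 1 / 2" using o[of \<xi>] by (simp add: \<delta>_def divide_le_eq)
    finally have "norm (S \<eta> u) \<le> 2 * onorm (S \<xi>) * norm u" by (rule S_locally_bounded)
    also have "\<dots> \<le> c * norm u"
    proof (rule mult_right_mono)
      have "2 * onorm (S \<xi>) \<le> (\<Sum>\<xi>\<in>F. 2 * onorm (S \<xi>))" using \<xi>(1) F(2) o by (intro member_le_sum) auto
      then show "2 * onorm (S \<xi>) \<le> c" by (simp add: c_def)
    qed simp
    finally show ?thesis .
  qed
  ultimately show ?thesis by blast
qed

end

section \<open>Decay rates for regularly varying resolvent growth\<close>

theorem theorem5p12:
  fixes T :: "real \<Rightarrow> 'a::complex_hilbert \<Rightarrow> 'a"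
    and D :: "'a set" and A :: "'a \<Rightarrow> 'a"
    and \<alpha> \<epsilon> a :: real and l k kd :: "real \<Rightarrow> real"
  assumes "C0_semigroup T" and "bounded_semigroup T"
    and "is_generator T D (\<lambda>x. - A x)"
    and "op_spectrum D A \<inter> {z. Re z = 0} = {}"
    and "\<alpha> > 0"
    and "slowly_varying_on a l" and "antimono_on {a..} l"
    and "(\<lambda>s::real. onorm (inv_into D (\<lambda>x. (\<i> * complex_of_real s) *\<^sub>C x + A x)))
           \<in> O[at_infinity](\<lambda>s. \<bar>s\<bar> powr \<alpha> / l \<bar>s\<bar>)"
    and "k = (\<lambda>t. 1 / l (t powr (1 / \<alpha>)))"
    and "de_Bruijn_conjugate k kd"
    and "\<epsilon> > 0"
  shows "(\<lambda>t. onorm (\<lambda>x. T t (inv_into D A x)))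
           \<in> O[at_top](\<lambda>t. (ln t) powr \<epsilon> / (t * kd t) powr (1 / \<alpha>))"
proof -
  define S where "S = (\<lambda>\<xi>. inv_into D (\<lambda>x. (\<i> * complex_of_real \<xi>) *\<^sub>C x + A x))"
  obtain M where M: "\<And>t. t \<ge> 0 \<Longrightarrow> onorm (T t) \<le> M" using assms(2) by (auto simp: bounded_semigroup_def)
  define K where "K = max 1 M"
  have T_bl: "bounded_linear (T t)" if "t \<ge> 0" for t
    using assms(1) that by (simp add: C0_semigroup_def bounded_clinear_def)
  have T_le: "norm (T t x) \<le> K * norm x" if "t \<ge> 0" for t x
  proof -
    have "norm (T t x) \<le> onorm (T t) * norm x" by (rule onorm[OF T_bl[OF that]])
    also have "\<dots> \<le> K * norm x" using M[OF that] by (intro mult_right_mono) (auto simp: K_def)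
    finally show ?thesis .
  qed
  have S_bij: "bij_betw (\<lambda>x. (\<i> * complex_of_real \<xi>) *\<^sub>C x + A x) D UNIV" (is "bij_betw ?f D UNIV")
    and S_bcl: "bounded_clinear (S \<xi>)" for \<xi>
  proof -
    let ?g = "\<lambda>x. (- (\<i> * complex_of_real \<xi>)) *\<^sub>C x - A x"
    have "- (\<i> * complex_of_real \<xi>) \<in> resolvent_set D A" using assms(4) by (auto simp: op_spectrum_def)
    then have g: "bij_betw ?g D UNIV" "bounded_clinear (inv_into D ?g)" by (auto simp: resolvent_set_def)
    have fg: "?f = (\<lambda>x. - ?g x)"
      by (simp add: fun_eq_iff bounded_bilinear.minus_left[OF bounded_bilinear_scaleC])
    have "bij_betw (uminus \<circ> ?g) D UNIV"
      by (rule bij_betw_trans[OF g(1)]) (simp add: bij_uminus)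
    then show f: "bij_betw ?f D UNIV" by (simp add: fg o_def)
    have "S \<xi> u = inv_into D ?g (- u)" for u
    proof -
      have v: "inv_into D ?g (- u) \<in> D" "?g (inv_into D ?g (- u)) = - u"
        using g(1) by (auto simp: bij_betw_def intro!: inv_into_into f_inv_into_f)
      have "?f (inv_into D ?g (- u)) = - ?g (inv_into D ?g (- u))" by (rule fun_cong[OF fg])
      also have "\<dots> = u" by (simp only: v(2) minus_minus)
      finally show ?thesis
        using inv_into_f_f[OF bij_betw_imp_inj_on[OF f] v(1)] by (simp add: S_def)
    qed
    then have S_eq: "S \<xi> = (\<lambda>u. inv_into D ?g (- u))" by (rule ext)
    have bl: "bounded_linear (\<lambda>u. inv_into D ?g (- u))"
      using g(2) by (intro bounded_linear_compose[OF _ bounded_linear_minus[OF bounded_linear_ident]]) (simp add: bounded_clinear_def)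
    have "inv_into D ?g (- (c *\<^sub>C u)) = c *\<^sub>C inv_into D ?g (- u)" for c u
    proof -
      have "- (c *\<^sub>C u) = c *\<^sub>C (- u)" by (simp add: bounded_bilinear.minus_right[OF bounded_bilinear_scaleC])
      then show ?thesis using g(2) by (simp add: bounded_clinear_def)
    qed
    with bl show "bounded_clinear (S \<xi>)" unfolding S_eq by (simp add: bounded_clinear_def)
  qed
  interpret imaginary_resolvent_semigroup T D A K S
  proof
    show "S \<xi> u \<in> D" for \<xi> u
      using S_bij[of \<xi>] unfolding S_def bij_betw_def by (intro inv_into_into) auto
    show "(\<i> * complex_of_real \<xi>) *\<^sub>C S \<xi> u + A (S \<xi> u) = u" for \<xi> u
      using S_bij[of \<xi>] f_inv_into_f[of u "\<lambda>x. (\<i> * complex_of_real \<xi>) *\<^sub>C x + A x" D]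
      unfolding S_def bij_betw_def by auto
    show "S \<xi> ((\<i> * complex_of_real \<xi>) *\<^sub>C x + A x) = x" if "x \<in> D" for \<xi> x
      unfolding S_def using inv_into_f_f[OF bij_betw_imp_inj_on[OF S_bij] that] .
  qed (use assms S_bcl T_le in \<open>auto simp: K_def\<close>)
  have S0: "inv_into D A = S 0"
    unfolding S_def by (simp add: bounded_bilinear.zero_left[OF bounded_bilinear_scaleC])
  have l_pos: "\<And>s. s \<ge> a \<Longrightarrow> l s > 0" and l_sv: "((\<lambda>s. l (2 * s) / l s) \<longlongrightarrow> 1) at_top"
    using assms(6) by (auto simp: slowly_varying_on_def)
  obtain c1 where c1: "c1 > 0" "\<forall>\<^sub>F s in at_infinity. norm (onorm (S s)) \<le> c1 * norm (\<bar>s\<bar> powr \<alpha> / l \<bar>s\<bar>)"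
    using landau_o.bigE[OF assms(8)] unfolding S_def by blast
  obtain b1 where b1: "\<And>s. b1 \<le> norm s \<Longrightarrow> norm (onorm (S s)) \<le> c1 * norm (\<bar>s\<bar> powr \<alpha> / l \<bar>s\<bar>)"
    using c1(2) by (auto simp: eventually_at_infinity)
  have "\<forall>\<^sub>F s in at_top. l (2 * s) / l s > 1 / 2" by (rule order_tendstoD(1)[OF l_sv]) simp
  then obtain b2 where b2: "\<And>s. s \<ge> b2 \<Longrightarrow> l (2 * s) / l s > 1 / 2" by (auto simp: eventually_at_top_linorder)
  \<comment> \<open>Beyond \<open>s0\<close> all asymptotic assumptions on \<open>l\<close> and the resolvent hold.\<close>
  define s0 where "s0 = Max {1, a, b1, b2}"
  have s0: "s0 \<ge> 1" "s0 \<ge> a" "s0 \<ge> b1" "s0 \<ge> b2" by (auto simp: s0_def)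
  have pos: "0 < l s" if "s0 \<le> s" for s using l_pos that s0 by simp
  have anti: "antimono_on {s0..} l" using assms(7) s0(2) by (auto simp: monotone_on_def)
  have dbl: "l s \<le> 2 * l (2 * s)" if "s0 \<le> s" for s
    using b2[of s] pos[OF that] that s0(4) by (simp add: field_simps)
  obtain C0 where C0: "C0 \<ge> 1" "\<And>\<xi> u. \<bar>\<xi>\<bar> \<le> s0 \<Longrightarrow> norm (S \<xi> u) \<le> C0 * norm u"
    using S_bounded_on_compact[of s0] by blast
  \<comment> \<open>The maximum with \<open>l s0\<close> makes the bound at least \<open>1\<close> at all frequencies.\<close>
  define C where "C = max c1 (l s0)"
  define N where "N = (\<lambda>\<xi>. if \<bar>\<xi>\<bar> < s0 then C0 else C * (\<bar>\<xi>\<bar> powr \<alpha> / l \<bar>\<xi>\<bar>))"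
  have N_bound: "norm (S \<xi> u) \<le> N \<xi> * norm u" for \<xi> u
  proof (cases "\<bar>\<xi>\<bar> < s0")
    case True
    then show ?thesis using C0(2)[of \<xi> u] by (simp add: N_def)
  next
    case False
    have "onorm (S \<xi>) \<le> c1 * (\<bar>\<xi>\<bar> powr \<alpha> / l \<bar>\<xi>\<bar>)"
      using b1[of \<xi>] False s0(3) pos[of "\<bar>\<xi>\<bar>"] by simp
    also have "\<dots> \<le> C * (\<bar>\<xi>\<bar> powr \<alpha> / l \<bar>\<xi>\<bar>)"
      using False pos[of "\<bar>\<xi>\<bar>"] by (intro mult_right_mono) (auto simp: C_def)
    also have "\<dots> = N \<xi>" using False by (simp add: N_def)
    finally show ?thesis by (intro order_trans[OF norm_S_le mult_right_mono]) auto
  qed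
  have N_ge: "N \<xi> \<ge> 1" for \<xi>
  proof (cases "\<bar>\<xi>\<bar> < s0")
    case False
    have "l \<bar>\<xi>\<bar> \<le> l s0" using monotone_onD[OF anti, of s0 "\<bar>\<xi>\<bar>"] False by simp
    also have "\<dots> \<le> C * \<bar>\<xi>\<bar> powr \<alpha>"
      using mult_mono[of "l s0" C 1 "\<bar>\<xi>\<bar> powr \<alpha>"] ge_one_powr_ge_zero[of "\<bar>\<xi>\<bar>" \<alpha>] False s0(1) assms(5) pos[of s0] by (auto simp: C_def)
    finally show ?thesis using False pos[of "\<bar>\<xi>\<bar>"] by (simp add: N_def)
  qed (simp add: N_def C0)
  \<comment> \<open>Enough powers of the resolvent to beat one power of the frequency.\<close>
  obtain j :: nat where j: "1 / \<alpha> \<le> real j" using real_arch_simple by blast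
  have j\<alpha>: "real (Suc j) * \<alpha> \<ge> 1"
  proof -
    have "1 / \<alpha> * \<alpha> \<le> real (Suc j) * \<alpha>" using j assms(5) by (intro mult_right_mono) auto
    then show ?thesis using assms(5) by simp
  qed
  have "\<exists>Q. \<forall>R t \<xi>. s0 \<le> R \<longrightarrow> R powr \<alpha> / l R \<le> 2 * t \<longrightarrow>
      exp (- (\<xi>\<^sup>2 / (2 * R\<^sup>2))) * (N \<xi> ^ Suc j / (1 + \<bar>\<xi>\<bar>)) \<le> Q * t ^ Suc j / R"
    unfolding N_def
    by (rule regularly_varying_growth[OF assms(5) j\<alpha> s0(1) pos anti dbl]) (use c1(1) C0(1) in \<open>auto simp: C_def\<close>)
  then obtain Q where Q: "\<And>R t \<xi>. s0 \<le> R \<Longrightarrow> R powr \<alpha> / l R \<le> 2 * t \<Longrightarrow>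
      exp (- (\<xi>\<^sup>2 / (2 * R\<^sup>2))) * (N \<xi> ^ Suc j / (1 + \<bar>\<xi>\<bar>)) \<le> Q * t ^ Suc j / R"
    by blast
  define B where "B = C0"
  have B: "norm (S 0 u) \<le> B * norm u" "B \<ge> 0" for u using C0 s0(1) by (auto simp: B_def)
  define Cst where "Cst = exp 1 * fact (Suc (Suc j)) * (K * (2 * B + 1)
      + K\<^sup>2 * ((1 + K) ^ j * (B + (1 + K) * (1 + B))) * Q)"
  obtain b where kd_pos: "\<And>s. s \<ge> b \<Longrightarrow> kd s > 0"
    and kdk: "((\<lambda>s. kd s * k (s * kd s)) \<longlongrightarrow> 1) at_top"
    using assms(10) by (auto simp: de_Bruijn_conjugate_def slowly_varying_on_def)
  show ?thesis
  proof (rule bigoI)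
    have ev: "\<forall>\<^sub>F t in at_top. kd t * k (t * kd t) < 2" by (rule order_tendstoD(2)[OF kdk]) simp
    show "\<forall>\<^sub>F t in at_top. norm (onorm (\<lambda>x. T t (inv_into D A x)))
        \<le> max Cst (K * B * s0) * norm ((ln t) powr \<epsilon> / (t * kd t) powr (1 / \<alpha>))"
      using ev eventually_ge_at_top[of b] eventually_ge_at_top[of "exp 1"]
    proof eventually_elim
      case (elim t)
      have t1: "t \<ge> 1" using elim(3) exp_ge_add_one_self[of 1] by simp
      define R where "R = (t * kd t) powr (1 / \<alpha>)"
      have tk: "t * kd t > 0" using t1 kd_pos[OF elim(2)] by simp
      have R: "R > 0" unfolding R_def powr_gt_zero by (rule less_imp_neq[OF tk, symmetric])
      have bl: "bounded_linear (\<lambda>x. T t (S 0 x))"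
        using bounded_linear_compose[OF bounded_linear_T bounded_linear_S] t1 by simp
      have "norm (T t (S 0 x)) \<le> max Cst (K * B * s0) / R * norm x" for x
      \<comment> \<open>For \<open>R < s0\<close> boundedness suffices, as then \<open>1 \<le> s0 / R\<close>; otherwise \<open>R\<close> is the scale at which the resolvent is of size \<open>t\<close>.\<close>
      proof (cases "s0 \<le> R")
        case True
        have "R powr \<alpha> = t * kd t" using assms(5) tk by (simp add: R_def powr_powr)
        moreover have "k (t * kd t) = 1 / l R" by (simp add: assms(9) R_def)
        ultimately have "R powr \<alpha> / l R = t * (kd t * k (t * kd t))" by simp
        also have "\<dots> \<le> t * 2" using elim(1) t1 by (intro mult_left_mono) auto
        finally have MR: "R powr \<alpha> / l R \<le> 2 * t" by simp
        have "norm (T t (S 0 x)) \<le> Cst / R * norm x"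
          unfolding Cst_def by (rule decay_from_resolvent_growth[OF t1 R N_bound N_ge B Q[OF True MR]])
        also have "\<dots> \<le> max Cst (K * B * s0) / R * norm x"
          using R by (intro mult_right_mono divide_right_mono) auto
        finally show ?thesis .
      next
        case False
        have "norm (T t (S 0 x)) \<le> K * norm (S 0 x)" using T_le t1 by simp
        also have "\<dots> \<le> K * (B * norm x)" using B K_ge_1 by (intro mult_left_mono) auto
        also have "\<dots> = K * B * 1 * norm x" by simp
        also have "\<dots> \<le> K * B * (s0 / R) * norm x"
          using False R K_ge_1 B(2) by (intro mult_right_mono mult_left_mono) auto
        also have "\<dots> \<le> max Cst (K * B * s0) / R * norm x"
          using R by (simp add: divide_right_mono mult_right_mono)
        finally show ?thesis .
      qed
      moreover have c_nonneg: "0 \<le> max Cst (K * B * s0) / R"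
        using K_ge_1 B(2) s0(1) R by (auto simp: le_max_iff_disj)
      ultimately have "onorm (\<lambda>x. T t (S 0 x)) \<le> max Cst (K * B * s0) / R"
        by (intro onorm_bound)
      also have "\<dots> = max Cst (K * B * s0) / R * 1" by simp
      also have "\<dots> \<le> max Cst (K * B * s0) / R * (ln t) powr \<epsilon>"
      proof (rule mult_left_mono[OF _ c_nonneg])
        have "ln t \<ge> 1" using elim(3) t1 by (simp add: ln_ge_iff)
        then show "1 \<le> (ln t) powr \<epsilon>" using assms(11) by (intro ge_one_powr_ge_zero) auto
      qed
      finally show ?case
        using onorm_pos_le[OF bl] R by (simp add: S0 R_def)
    qed
  qed
qed

end
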